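(* Let $(P,\cdot,\{~,~\})$ be a Poisson algebra over a field $\mathbf{k}$ of characteristic $0$, let $(V,\mu,\rho)$ be a representation of it, and let $0\to V\xrightarrow{i}E\xrightarrow{p}P\to 0$ be an abelian extension of $P$ by the representation $(V,\mu,\rho)$. Then there is an exact sequence $$0\to\mathrm{Der}(P,V)\xrightarrow{\iota}\mathrm{Der}_V(E)\xrightarrow{\eta}\mathcal{D}_{\mu,\rho}\xrightarrow{\mathcal{W}}H^2_{\mathrm{FGV}}(P,V),$$ where the map $\iota$ is given by $\iota(D)(e)=D(p(e))$ for $D\in\mathrm{Der}(P,V)$ and $e\in E$.
   Context: A Poisson algebra $(P,\cdot,\{~,~\})$ is a commutative associative algebra $(P,\cdot)$ that is also a Lie algebra $(P,\{~,~\})$, with $\{x,y\cdot z\}=\{x,y\}\cdot z+y\cdot\{x,z\}$. A representation $(V,\mu,\rho)$ of it is a vector space $V$ with linear maps $\mu,\rho:P\to\mathrm{End}(V)$ such that for all $x,y\in P$: $\mu_{x\cdot y}=\mu_x\mu_y$, $\rho_{\{x,y\}}=\rho_x\rho_y-\rho_y\rho_x$, $\mu_{\{x,y\}}=\rho_x\mu_y-\mu_y\rho_x$, $\rho_{x\cdot y}=\mu_x\rho_y+\mu_y\rho_x$. An abelian extension of $P$ by $(V,\mu,\rho)$ is a short exact sequence of Poisson algebras $0\to V\xrightarrow{i}E\xrightarrow{p}P\to0$, where $V$ carries the trivial (zero) product and bracket, such that, identifying $V$ with $i(V)\subset E$, one has $\mu_xv=s(x)\cdot_Ev$ and $\rho_xv=\{s(x),v\}_E$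 for $x\in P$, $v\in V$ and any linear section $s:P\to E$ of $p$ (i.e. $ps=\mathrm{id}_P$). A Poisson derivation of a Poisson algebra is a linear endomorphism that is a derivation for both the product and the bracket; $\mathrm{Der}$ denotes the space of these (so $\mathrm{Der}(V)=\mathrm{End}(V)$). $\mathrm{Der}(P,V)$ is the space of linear maps $D:P\to V$ with $D(x\cdot y)=\mu_xD(y)+\mu_yD(x)$ and $D(\{x,y\})=\rho_xD(y)-\rho_yD(x)$ for all $x,y\in P$. $\mathrm{Der}_V(E)$ is the space of Poisson derivations $d$ of $E$ with $d(V)\subset V$. The map $\eta$ is $\eta(d)=(d|_V,pds)$ for any linear section $s$ (independent of $s$). $\mathcal{D}_{\mu,\rho}$ is the space of $(d_V,d_P)\in\mathrm{Der}(V)\times\mathrm{Der}(P)$ such that $d_V(\mu_xv)=\mu_{d_P(x)}v+\mu_xd_V(v)$ and $d_V(\rho_xv)=\rho_{d_P(x)}v+\rho_xd_V(v)$ for all $x\in P$, $v\in V$; the image of $\eta$ lies in $\mathcal{D}_{\mu,\rho}$. Second (Flato-Gerstenhaber-Voronov) Poisson cohomology $H^2_{\mathrm{FGV}}(P,V)$: a Poisson $2$-cocycle is a pair $(h,H)$ with $h:P\times P\to V$ symmetric bilinear and $H:P\times P\to V$ skew-symmetric bilinear, satisfying for all $x,y,z\in P$ (1) $\mu_xh(y,z)-h(x\cdot y,z)+h(x,y\cdot z)-\mu_zh(x,y)=0$; (2) $\rho_xH(y,z)+\rho_yH(z,x)+\rho_zH(x,y)+H(x,\{y,z\})+H(y,\{z,x\})+H(z,\{x,y\})=0$;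 (3) $\rho_xh(y,z)-h(\{x,y\},z)-h(y,\{x,z\})+H(x,y\cdot z)-\mu_yH(x,z)-\mu_zH(x,y)=0$. Two $2$-cocycles $(h,H)$, $(h',H')$ are cohomologous if there is a linear map $\varphi:P\to V$ with $h(x,y)-h'(x,y)=\mu_x\varphi(y)-\varphi(x\cdot y)+\mu_y\varphi(x)$ and $H(x,y)-H'(x,y)=\rho_x\varphi(y)-\varphi(\{x,y\})-\rho_y\varphi(x)$. $H^2_{\mathrm{FGV}}(P,V)$ is the vector space of $2$-cocycles modulo this relation. Wells map: choose a linear section $s$ of $p$ and put $h(x,y)=s(x)\cdot_Es(y)-s(x\cdot y)$, $H(x,y)=\{s(x),s(y)\}_E-s(\{x,y\})$; $(h,H)$ is a Poisson $2$-cocycle. For $(d_V,d_P)\in\mathcal{D}_{\mu,\rho}$ set $h_{(d_V,d_P)}(x,y)=d_V(h(x,y))-h(d_P(x),y)-h(x,d_P(y))$ and $H_{(d_V,d_P)}(x,y)=d_V(H(x,y))-H(d_P(x),y)-H(x,d_P(y))$; this is again a $2$-cocycle. Define $\mathcal{W}:\mathcal{D}_{\mu,\rho}\to H^2_{\mathrm{FGV}}(P,V)$ by $\mathcal{W}(d_V,d_P)=[(h_{(d_V,d_P)},H_{(d_V,d_P)})]$; it does not depend on the choice of $s$. *)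

theory Defs
  imports Complex_Main "HOL-Library.FuncSet" "HOL-Library.Function_Algebras" "HOL-Library.Product_Plus"
begin

section \<open>Poisson algebras and representations\<close>

text \<open>The underlying vector spaces of algebras and representations are whole types; the scalar
  multiplication is explicit, since the ground field is arbitrary.\<close>

record ('k, 'a) poisson =
  pscale :: "'k \<Rightarrow> 'a \<Rightarrow> 'a"
  pmult :: "'a \<Rightarrow> 'a \<Rightarrow> 'a"  (infixl \<open>\<odot>\<index>\<close> 70)
  pbrk :: "'a \<Rightarrow> 'a \<Rightarrow> 'a"  (\<open>\<lbrace>_,/ _\<rbrace>\<index>\<close>)

definition bilinear_map ::
  "('k::field \<Rightarrow> 'a::ab_group_add \<Rightarrow> 'a) \<Rightarrow> ('k \<Rightarrow> 'b::ab_group_add \<Rightarrow> 'b) \<Rightarrow>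
   ('k \<Rightarrow> 'c::ab_group_add \<Rightarrow> 'c) \<Rightarrow> ('a \<Rightarrow> 'b \<Rightarrow> 'c) \<Rightarrow> bool" where
  "bilinear_map sA sB sC f \<longleftrightarrow>
     (\<forall>x. Vector_Spaces.linear sB sC (f x)) \<and> (\<forall>y. Vector_Spaces.linear sA sC (\<lambda>x. f x y))"

locale poisson_algebra =
  fixes P :: "('k::field, 'a::ab_group_add) poisson" (structure)
  assumes vector_space: "vector_space (pscale P)"
    and mult_bilinear: "bilinear_map (pscale P) (pscale P) (pscale P) (pmult P)"
    and mult_assoc: "\<And>x y z. (x \<odot> y) \<odot> z = x \<odot> (y \<odot> z)"
    and mult_commute: "\<And>x y. x \<odot> y = y \<odot> x"
    and brk_bilinear: "bilinear_map (pscale P) (pscale P) (pscale P) (pbrk P)"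
    and brk_self: "\<And>x. \<lbrace>x, x\<rbrace> = 0"
    and jacobi: "\<And>x y z. \<lbrace>x, \<lbrace>y, z\<rbrace>\<rbrace> + \<lbrace>y, \<lbrace>z, x\<rbrace>\<rbrace> + \<lbrace>z, \<lbrace>x, y\<rbrace>\<rbrace> = 0"
    and leibniz: "\<And>x y z. \<lbrace>x, y \<odot> z\<rbrace> = \<lbrace>x, y\<rbrace> \<odot> z + y \<odot> \<lbrace>x, z\<rbrace>"

definition trivial_poisson :: "('k \<Rightarrow> 'v \<Rightarrow> 'v) \<Rightarrow> ('k, 'v::zero) poisson" where
  "trivial_poisson sV = \<lparr>pscale = sV, pmult = (\<lambda>_ _. 0), pbrk = (\<lambda>_ _. 0)\<rparr>"

definition poisson_hom ::
  "('k::field, 'a::ab_group_add) poisson \<Rightarrow> ('k, 'b::ab_group_add) poisson \<Rightarrow> ('a \<Rightarrow> 'b) \<Rightarrow> bool" where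
  "poisson_hom A B f \<longleftrightarrow> Vector_Spaces.linear (pscale A) (pscale B) f \<and>
     (\<forall>x y. f (x \<odot>\<^bsub>A\<^esub> y) = f x \<odot>\<^bsub>B\<^esub> f y) \<and> (\<forall>x y. f \<lbrace>x, y\<rbrace>\<^bsub>A\<^esub> = \<lbrace>f x, f y\<rbrace>\<^bsub>B\<^esub>)"

definition poisson_Der :: "('k::field, 'a::ab_group_add) poisson \<Rightarrow> ('a \<Rightarrow> 'a) set" where
  "poisson_Der A = {d. Vector_Spaces.linear (pscale A) (pscale A) d \<and>
     (\<forall>x y. d (x \<odot>\<^bsub>A\<^esub> y) = d x \<odot>\<^bsub>A\<^esub> y + x \<odot>\<^bsub>A\<^esub> d y) \<and>
     (\<forall>x y. d \<lbrace>x, y\<rbrace>\<^bsub>A\<^esub> = \<lbrace>d x, y\<rbrace>\<^bsub>A\<^esub> + \<lbrace>x, d y\<rbrace>\<^bsub>A\<^esub>)}"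

locale poisson_rep = poisson_algebra P
  for P :: "('k::field, 'p::ab_group_add) poisson" (structure) +
  fixes sV :: "'k \<Rightarrow> 'v::ab_group_add \<Rightarrow> 'v"
    and \<mu> \<rho> :: "'p \<Rightarrow> 'v \<Rightarrow> 'v"
  assumes mu_bilinear: "bilinear_map (pscale P) sV sV \<mu>"
    and rho_bilinear: "bilinear_map (pscale P) sV sV \<rho>"
    and mu_mult: "\<And>x y v. \<mu> (x \<odot> y) v = \<mu> x (\<mu> y v)"
    and rho_brk: "\<And>x y v. \<rho> \<lbrace>x, y\<rbrace> v = \<rho> x (\<rho> y v) - \<rho> y (\<rho> x v)"
    and mu_brk: "\<And>x y v. \<mu> \<lbrace>x, y\<rbrace> v = \<rho> x (\<mu> y v) - \<mu> y (\<rho> x v)"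
    and rho_mult: "\<And>x y v. \<rho> (x \<odot> y) v = \<mu> x (\<rho> y v) + \<mu> y (\<rho> x v)"


section \<open>Abelian extensions\<close>

definition linear_section ::
  "('k::field, 'p::ab_group_add) poisson \<Rightarrow> ('k, 'e::ab_group_add) poisson \<Rightarrow>
   ('e \<Rightarrow> 'p) \<Rightarrow> ('p \<Rightarrow> 'e) \<Rightarrow> bool" where
  "linear_section P E p s \<longleftrightarrow> Vector_Spaces.linear (pscale P) (pscale E) s \<and> p \<circ> s = id"

locale abelian_extension = poisson_rep P sV \<mu> \<rho>
  for P :: "('k::field, 'p::ab_group_add) poisson"
    and sV :: "'k \<Rightarrow> 'v::ab_group_add \<Rightarrow> 'v"
    and \<mu> \<rho> :: "'p \<Rightarrow> 'v \<Rightarrow> 'v" +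
  fixes E :: "('k, 'e::ab_group_add) poisson"
    and i :: "'v \<Rightarrow> 'e"
    and p :: "'e \<Rightarrow> 'p"
  assumes E: "poisson_algebra E"
    and i_hom: "poisson_hom (trivial_poisson sV) E i"
    and p_hom: "poisson_hom E P p"
    and i_inj: "inj i"
    and range_i: "range i = {e. p e = 0}"
    and p_surj: "surj p"
    and mu_section: "\<And>s x v. linear_section P E p s \<Longrightarrow> i (\<mu> x v) = s x \<odot>\<^bsub>E\<^esub> i v"
    and rho_section: "\<And>s x v. linear_section P E p s \<Longrightarrow> i (\<rho> x v) = \<lbrace>s x, i v\<rbrace>\<^bsub>E\<^esub>"
begin

text \<open>Linear sections exist, so statements quantified over them are not vacuous.\<close>

lemma linear_section_exists: "\<exists>s. linear_section P E p s"
proof -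
  have p: "Vector_Spaces.linear (pscale E) (pscale P) p"
    using p_hom by (simp add: poisson_hom_def)
  interpret vector_space_pair "pscale E" "pscale P"
    using E vector_space by (simp add: vector_space_pair_def poisson_algebra.vector_space)
  from linear_surjective_right_inverse[OF p p_surj] show ?thesis
    unfolding linear_section_def by blast
qed

end


section \<open>Vector spaces on explicit carriers and exact sequences\<close>

text \<open>The terms of the exact sequence are subspaces of function spaces and a quotient space that
  depend on term parameters, so they carry their own linear structure.\<close>

record ('k, 'a) vspace =
  vcarrier :: "'a set"
  vadd :: "'a \<Rightarrow> 'a \<Rightarrow> 'a"
  vzero :: "'a"
  vscale :: "'k \<Rightarrow> 'a \<Rightarrow> 'a"

locale vspace =
  fixes A :: "('k::field, 'a) vspace"
  assumes add_closed: "\<And>x y. x \<in> vcarrier A \<Longrightarrow> y \<in> vcarrier A \<Longrightarrow> vadd A x y \<in> vcarrier A"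
    and zero_closed: "vzero A \<in> vcarrier A"
    and scale_closed: "\<And>c x. x \<in> vcarrier A \<Longrightarrow> vscale A c x \<in> vcarrier A"
    and add_assoc: "\<And>x y z. x \<in> vcarrier A \<Longrightarrow> y \<in> vcarrier A \<Longrightarrow> z \<in> vcarrier A \<Longrightarrow>
          vadd A (vadd A x y) z = vadd A x (vadd A y z)"
    and add_commute: "\<And>x y. x \<in> vcarrier A \<Longrightarrow> y \<in> vcarrier A \<Longrightarrow> vadd A x y = vadd A y x"
    and add_zero: "\<And>x. x \<in> vcarrier A \<Longrightarrow> vadd A (vzero A) x = x"
    and add_inverse: "\<And>x. x \<in> vcarrier A \<Longrightarrow> \<exists>y\<in>vcarrier A. vadd A x y = vzero A"
    and scale_add_right: "\<And>c x y. x \<in> vcarrier A \<Longrightarrow> y \<in> vcarrier A \<Longrightarrow>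
          vscale A c (vadd A x y) = vadd A (vscale A c x) (vscale A c y)"
    and scale_add_left: "\<And>c d x. x \<in> vcarrier A \<Longrightarrow>
          vscale A (c + d) x = vadd A (vscale A c x) (vscale A d x)"
    and scale_scale: "\<And>c d x. x \<in> vcarrier A \<Longrightarrow> vscale A c (vscale A d x) = vscale A (c * d) x"
    and scale_one: "\<And>x. x \<in> vcarrier A \<Longrightarrow> vscale A 1 x = x"

definition vlinear :: "('k::field, 'a) vspace \<Rightarrow> ('k, 'b) vspace \<Rightarrow> ('a \<Rightarrow> 'b) \<Rightarrow> bool" where
  "vlinear A B f \<longleftrightarrow> vspace A \<and> vspace B \<and> f \<in> vcarrier A \<rightarrow> vcarrier B \<and>
     (\<forall>x\<in>vcarrier A. \<forall>y\<in>vcarrier A. f (vadd A x y) = vadd B (f x) (f y)) \<and>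
     (\<forall>c. \<forall>x\<in>vcarrier A. f (vscale A c x) = vscale B c (f x))"

definition vkernel :: "('k, 'a) vspace \<Rightarrow> ('k, 'b) vspace \<Rightarrow> ('a \<Rightarrow> 'b) \<Rightarrow> 'a set" where
  "vkernel A B f = {x \<in> vcarrier A. f x = vzero B}"

text \<open>Exactness of a sequence \<open>0 \<rightarrow> A \<rightarrow> B \<rightarrow> C \<rightarrow> D\<close> of vector spaces, with maps \<open>f\<close>, \<open>g\<close>, \<open>h\<close>.\<close>

definition exact_0_4 ::
  "('k::field, 'a) vspace \<Rightarrow> ('a \<Rightarrow> 'b) \<Rightarrow> ('k, 'b) vspace \<Rightarrow> ('b \<Rightarrow> 'c) \<Rightarrow>
   ('k, 'c) vspace \<Rightarrow> ('c \<Rightarrow> 'd) \<Rightarrow> ('k, 'd) vspace \<Rightarrow> bool" where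
  "exact_0_4 A f B g C h D \<longleftrightarrow>
     vlinear A B f \<and> vlinear B C g \<and> vlinear C D h \<and>
     {vzero A} = vkernel A B f \<and>
     f ` vcarrier A = vkernel B C g \<and>
     g ` vcarrier B = vkernel C D h"

text \<open>A subset of a function or product space, with the ambient (pointwise) operations.\<close>

definition sub_vspace ::
  "'a set \<Rightarrow> ('k \<Rightarrow> 'a \<Rightarrow> 'a) \<Rightarrow> ('k, 'a::ab_group_add) vspace" where
  "sub_vspace S sc = \<lparr>vcarrier = S, vadd = (+), vzero = 0, vscale = sc\<rparr>"

definition fun_scale :: "('k \<Rightarrow> 'b \<Rightarrow> 'b) \<Rightarrow> 'k \<Rightarrow> ('a \<Rightarrow> 'b) \<Rightarrow> ('a \<Rightarrow> 'b)" where
  "fun_scale sc c f = (\<lambda>x. sc c (f x))"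

definition pair_scale :: "('k \<Rightarrow> 'a \<Rightarrow> 'a) \<Rightarrow> ('k \<Rightarrow> 'b \<Rightarrow> 'b) \<Rightarrow> 'k \<Rightarrow> 'a \<times> 'b \<Rightarrow> 'a \<times> 'b" where
  "pair_scale sa sb c = (\<lambda>(a, b). (sa c a, sb c b))"


section \<open>Poisson cohomology in degree two\<close>

type_synonym ('p, 'v) cochain2 = "('p \<Rightarrow> 'p \<Rightarrow> 'v) \<times> ('p \<Rightarrow> 'p \<Rightarrow> 'v)"

definition cocycles2 ::
  "('k::field, 'p::ab_group_add) poisson \<Rightarrow> ('k \<Rightarrow> 'v::ab_group_add \<Rightarrow> 'v) \<Rightarrow>
   ('p \<Rightarrow> 'v \<Rightarrow> 'v) \<Rightarrow> ('p \<Rightarrow> 'v \<Rightarrow> 'v) \<Rightarrow> ('p, 'v) cochain2 set" where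
  "cocycles2 P sV \<mu> \<rho> = {(h, H).
     bilinear_map (pscale P) (pscale P) sV h \<and> (\<forall>x y. h x y = h y x) \<and>
     bilinear_map (pscale P) (pscale P) sV H \<and> (\<forall>x y. H x y = - H y x) \<and>
     (\<forall>x y z. \<mu> x (h y z) - h (x \<odot>\<^bsub>P\<^esub> y) z + h x (y \<odot>\<^bsub>P\<^esub> z) - \<mu> z (h x y) = 0) \<and>
     (\<forall>x y z. \<rho> x (H y z) + \<rho> y (H z x) + \<rho> z (H x y)
        + H x \<lbrace>y, z\<rbrace>\<^bsub>P\<^esub> + H y \<lbrace>z, x\<rbrace>\<^bsub>P\<^esub> + H z \<lbrace>x, y\<rbrace>\<^bsub>P\<^esub> = 0) \<and>
     (\<forall>x y z. \<rho> x (h y z) - h \<lbrace>x, y\<rbrace>\<^bsub>P\<^esub> z - h y \<lbrace>x, z\<rbrace>\<^bsub>P\<^esub>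
        + H x (y \<odot>\<^bsub>P\<^esub> z) - \<mu> y (H x z) - \<mu> z (H x y) = 0)}"

definition cohomologous ::
  "('k::field, 'p::ab_group_add) poisson \<Rightarrow> ('k \<Rightarrow> 'v::ab_group_add \<Rightarrow> 'v) \<Rightarrow>
   ('p \<Rightarrow> 'v \<Rightarrow> 'v) \<Rightarrow> ('p \<Rightarrow> 'v \<Rightarrow> 'v) \<Rightarrow> ('p, 'v) cochain2 rel" where
  "cohomologous P sV \<mu> \<rho> = {((h, H), (h', H')).
     (h, H) \<in> cocycles2 P sV \<mu> \<rho> \<and> (h', H') \<in> cocycles2 P sV \<mu> \<rho> \<and>
     (\<exists>\<phi>. Vector_Spaces.linear (pscale P) sV \<phi> \<and>
        (\<forall>x y. h x y - h' x y = \<mu> x (\<phi> y) - \<phi> (x \<odot>\<^bsub>P\<^esub> y) + \<mu> y (\<phi> x)) \<and>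
        (\<forall>x y. H x y - H' x y = \<rho> x (\<phi> y) - \<phi> \<lbrace>x, y\<rbrace>\<^bsub>P\<^esub> - \<rho> y (\<phi> x)))}"

definition coho_class ::
  "('k::field, 'p::ab_group_add) poisson \<Rightarrow> ('k \<Rightarrow> 'v::ab_group_add \<Rightarrow> 'v) \<Rightarrow>
   ('p \<Rightarrow> 'v \<Rightarrow> 'v) \<Rightarrow> ('p \<Rightarrow> 'v \<Rightarrow> 'v) \<Rightarrow> ('p, 'v) cochain2 \<Rightarrow> ('p, 'v) cochain2 set" where
  "coho_class P sV \<mu> \<rho> c = cohomologous P sV \<mu> \<rho> `` {c}"

text \<open>The operations on classes are induced by those on representatives.\<close>

definition H2_FGV ::
  "('k::field, 'p::ab_group_add) poisson \<Rightarrow> ('k \<Rightarrow> 'v::ab_group_add \<Rightarrow> 'v) \<Rightarrow>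
   ('p \<Rightarrow> 'v \<Rightarrow> 'v) \<Rightarrow> ('p \<Rightarrow> 'v \<Rightarrow> 'v) \<Rightarrow> ('k, ('p, 'v) cochain2 set) vspace" where
  "H2_FGV P sV \<mu> \<rho> =
     \<lparr>vcarrier = cocycles2 P sV \<mu> \<rho> // cohomologous P sV \<mu> \<rho>,
      vadd = (\<lambda>X Y. \<Union>a\<in>X. \<Union>b\<in>Y. coho_class P sV \<mu> \<rho> (a + b)),
      vzero = coho_class P sV \<mu> \<rho> 0,
      vscale = (\<lambda>c X. \<Union>a\<in>X. coho_class P sV \<mu> \<rho>
         (pair_scale (fun_scale (fun_scale sV)) (fun_scale (fun_scale sV)) c a))\<rparr>"


section \<open>The other terms and the maps of the sequence\<close>

definition Der_rep ::
  "('k::field, 'p::ab_group_add) poisson \<Rightarrow> ('k \<Rightarrow> 'v::ab_group_add \<Rightarrow> 'v) \<Rightarrow>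
   ('p \<Rightarrow> 'v \<Rightarrow> 'v) \<Rightarrow> ('p \<Rightarrow> 'v \<Rightarrow> 'v) \<Rightarrow> ('k, 'p \<Rightarrow> 'v) vspace" where
  "Der_rep P sV \<mu> \<rho> = sub_vspace
     {D. Vector_Spaces.linear (pscale P) sV D \<and>
         (\<forall>x y. D (x \<odot>\<^bsub>P\<^esub> y) = \<mu> x (D y) + \<mu> y (D x)) \<and>
         (\<forall>x y. D \<lbrace>x, y\<rbrace>\<^bsub>P\<^esub> = \<rho> x (D y) - \<rho> y (D x))}
     (fun_scale sV)"

definition Der_ext ::
  "('k::field, 'e::ab_group_add) poisson \<Rightarrow> ('v \<Rightarrow> 'e) \<Rightarrow> ('k, 'e \<Rightarrow> 'e) vspace" where
  "Der_ext E i = sub_vspace {d \<in> poisson_Der E. d ` range i \<subseteq> range i} (fun_scale (pscale E))"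

definition compat_Der ::
  "('k::field, 'p::ab_group_add) poisson \<Rightarrow> ('k \<Rightarrow> 'v::ab_group_add \<Rightarrow> 'v) \<Rightarrow>
   ('p \<Rightarrow> 'v \<Rightarrow> 'v) \<Rightarrow> ('p \<Rightarrow> 'v \<Rightarrow> 'v) \<Rightarrow> ('k, ('v \<Rightarrow> 'v) \<times> ('p \<Rightarrow> 'p)) vspace" where
  "compat_Der P sV \<mu> \<rho> = sub_vspace
     {(dV, dP). dV \<in> poisson_Der (trivial_poisson sV) \<and> dP \<in> poisson_Der P \<and>
        (\<forall>x v. dV (\<mu> x v) = \<mu> (dP x) v + \<mu> x (dV v)) \<and>
        (\<forall>x v. dV (\<rho> x v) = \<rho> (dP x) v + \<rho> x (dV v))}
     (pair_scale (fun_scale sV) (fun_scale (pscale P)))"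

text \<open>Below, \<open>inv i\<close> (used only on \<open>range i\<close>) carries out the identification of \<open>V\<close> with
  \<open>i V\<close>.\<close>

definition iota_map :: "('v \<Rightarrow> 'e) \<Rightarrow> ('e \<Rightarrow> 'p) \<Rightarrow> ('p \<Rightarrow> 'v) \<Rightarrow> ('e \<Rightarrow> 'e)" where
  "iota_map i p D = (\<lambda>e. i (D (p e)))"

definition eta_map ::
  "('v \<Rightarrow> 'e) \<Rightarrow> ('e \<Rightarrow> 'p) \<Rightarrow> ('p \<Rightarrow> 'e) \<Rightarrow> ('e \<Rightarrow> 'e) \<Rightarrow> ('v \<Rightarrow> 'v) \<times> ('p \<Rightarrow> 'p)" where
  "eta_map i p s d = (inv i \<circ> d \<circ> i, p \<circ> d \<circ> s)"

definition section_cocycle ::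
  "('k, 'p) poisson \<Rightarrow> ('k, 'e::ab_group_add) poisson \<Rightarrow> ('v \<Rightarrow> 'e) \<Rightarrow> ('p \<Rightarrow> 'e) \<Rightarrow>
   ('p, 'v) cochain2" where
  "section_cocycle P E i s =
     ((\<lambda>x y. inv i (s x \<odot>\<^bsub>E\<^esub> s y - s (x \<odot>\<^bsub>P\<^esub> y))),
      (\<lambda>x y. inv i (\<lbrace>s x, s y\<rbrace>\<^bsub>E\<^esub> - s \<lbrace>x, y\<rbrace>\<^bsub>P\<^esub>)))"

definition deform ::
  "('v \<Rightarrow> 'v) \<times> ('p \<Rightarrow> 'p) \<Rightarrow> ('p \<Rightarrow> 'p \<Rightarrow> 'v::ab_group_add) \<Rightarrow> ('p \<Rightarrow> 'p \<Rightarrow> 'v)" where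
  "deform = (\<lambda>(dV, dP) h x y. dV (h x y) - h (dP x) y - h x (dP y))"

definition wells_map ::
  "('k::field, 'p::ab_group_add) poisson \<Rightarrow> ('k \<Rightarrow> 'v::ab_group_add \<Rightarrow> 'v) \<Rightarrow>
   ('p \<Rightarrow> 'v \<Rightarrow> 'v) \<Rightarrow> ('p \<Rightarrow> 'v \<Rightarrow> 'v) \<Rightarrow> ('k, 'e::ab_group_add) poisson \<Rightarrow>
   ('v \<Rightarrow> 'e) \<Rightarrow> ('p \<Rightarrow> 'e) \<Rightarrow> ('v \<Rightarrow> 'v) \<times> ('p \<Rightarrow> 'p) \<Rightarrow> ('p, 'v) cochain2 set" where
  "wells_map P sV \<mu> \<rho> E i s d =
     (case section_cocycle P E i s of (h, H) \<Rightarrow> coho_class P sV \<mu> \<rho> (deform d h, deform d H))"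

end

theory Submission
  imports Defs
begin

text \<open>A section \<open>s\<close> splits \<open>E\<close> linearly as \<open>s P \<oplus> i V\<close>, and in these coordinates the product and
  bracket of \<open>E\<close> are those of the semidirect product twisted by the cocycle \<open>(h, H)\<close> of \<open>s\<close>. A
  linear endomorphism of \<open>E\<close> preserving \<open>V\<close> is a block triangular matrix with diagonal \<open>(dV, dP)\<close> and
  off-diagonal entry \<open>\<phi> : P \<rightarrow> V\<close>. It is a Poisson derivation iff \<open>(dV, dP)\<close> is a compatible pair and
  the deformed cocycle of \<open>(dV, dP)\<close> is the coboundary of \<open>\<phi>\<close>. For \<open>(dV, dP) = 0\<close> this condition
  says that \<open>\<phi>\<close> is in \<open>Der(P, V)\<close>, which is exactness at \<open>Der\<^sub>V(E)\<close>; the existence of a suitable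
  \<open>\<phi>\<close> is the vanishing of the Wells class, which is exactness at the compatible pairs.\<close>

section \<open>Linear and bilinear maps\<close>

lemma linear_simps:
  assumes "Vector_Spaces.linear s1 s2 f"
  shows "f (x + y) = f x + f y" "f (x - y) = f x - f y" "f (- x) = - f x" "f 0 = 0"
    "f (s1 c x) = s2 c (f x)"
proof -
  interpret Vector_Spaces.linear s1 s2 f by fact
  show "f (x + y) = f x + f y" "f (x - y) = f x - f y" "f (- x) = - f x" "f 0 = 0"
    "f (s1 c x) = s2 c (f x)"
    by (simp_all add: add diff neg scale)
qed

lemma linear_comp:
  assumes "Vector_Spaces.linear s1 s2 f" "Vector_Spaces.linear s2 s3 g"
  shows "Vector_Spaces.linear s1 s3 (\<lambda>x. g (f x))"
  using assms by (simp add: Vector_Spaces.linear_iff)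

lemma linear_zero:
  assumes "vector_space s1" "vector_space s2"
  shows "Vector_Spaces.linear s1 s2 0"
  using assms
  by (simp add: Vector_Spaces.linear_iff module.scale_zero_right module_iff_vector_space)

lemma linear_plus:
  assumes "Vector_Spaces.linear s1 s2 f" "Vector_Spaces.linear s1 s2 g"
  shows "Vector_Spaces.linear s1 s2 (f + g)"
  using assms by (simp add: Vector_Spaces.linear_iff vector_space_def algebra_simps)

lemma linear_fun_scale:
  assumes "Vector_Spaces.linear s1 s2 f"
  shows "Vector_Spaces.linear s1 s2 (fun_scale s2 c f)"
  using assms by (simp add: Vector_Spaces.linear_iff fun_scale_def vector_space_def mult.commute)

lemma bilinear_map_simps:
  assumes "bilinear_map sA sB sC f"
  shows "f (x + x') y = f x y + f x' y" "f x (y + y') = f x y + f x y'"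
    "f (x - x') y = f x y - f x' y" "f x (y - y') = f x y - f x y'"
    "f (- x) y = - f x y" "f x (- y) = - f x y"
    "f 0 y = 0" "f x 0 = 0"
    "f (sA c x) y = sC c (f x y)" "f x (sB c y) = sC c (f x y)"
  using linear_simps[of sA sC "\<lambda>x. f x y"] linear_simps[of sB sC "f x"] assms
  unfolding bilinear_map_def by blast+

lemma bilinear_mapD:
  assumes "bilinear_map sA sB sC f"
  shows "Vector_Spaces.linear sB sC (f x)" "Vector_Spaces.linear sA sC (\<lambda>x. f x y)"
    "vector_space sA" "vector_space sB" "vector_space sC"
  using assms by (auto simp: bilinear_map_def Vector_Spaces.linear_iff)

lemma bilinear_map_zero:
  assumes "vector_space sA" "vector_space sB" "vector_space sC"
  shows "bilinear_map sA sB sC 0"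
  using assms linear_zero[of sA sC] linear_zero[of sB sC]
  by (simp add: bilinear_map_def zero_fun_def)

lemma bilinear_map_plus:
  assumes "bilinear_map sA sB sC f" "bilinear_map sA sB sC g"
  shows "bilinear_map sA sB sC (f + g)"
  using assms linear_plus[of sA sC "\<lambda>x. f x y" "\<lambda>x. g x y" for y]
    linear_plus[of sB sC "f x" "g x" for x]
  by (simp add: bilinear_map_def plus_fun_def)

lemma bilinear_map_fun_scale:
  assumes "bilinear_map sA sB sC f"
  shows "bilinear_map sA sB sC (fun_scale (fun_scale sC) c f)"
  using assms linear_fun_scale[of sA sC "\<lambda>x. f x y" c for y]
    linear_fun_scale[of sB sC "f x" c for x]
  by (simp add: bilinear_map_def fun_scale_def)

text \<open>Together with the next rules, this gives bilinearity of the cocycle of a section and of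
  its deformations by composing known bilinear and linear maps.\<close>

lemma bilinear_map_precompose:
  assumes "bilinear_map sA sB sC f" "Vector_Spaces.linear sA' sA g"
  shows "bilinear_map sA' sB sC (\<lambda>x y. f (g x) y)"
  using assms linear_comp[of sA' sA g sC "\<lambda>x. f x y" for y] by (simp add: bilinear_map_def)

lemma bilinear_map_precompose':
  assumes "bilinear_map sA sB sC f" "Vector_Spaces.linear sB' sB g"
  shows "bilinear_map sA sB' sC (\<lambda>x y. f x (g y))"
  using assms linear_comp[of sB' sB g sC "f x" for x] by (simp add: bilinear_map_def)

lemma bilinear_map_postcompose:
  assumes "bilinear_map sA sB sC f" "Vector_Spaces.linear sC sD g"
  shows "bilinear_map sA sB sD (\<lambda>x y. g (f x y))"
  using assms linear_comp[of sA sC "\<lambda>x. f x y" sD g for y] linear_comp[of sB sC "f x" sD g for x]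
  by (simp add: bilinear_map_def)

lemma bilinear_map_diff:
  assumes "bilinear_map sA sB sC f" "bilinear_map sA sB sC g"
  shows "bilinear_map sA sB sC (\<lambda>x y. f x y - g x y)"
proof -
  interpret vector_space sC by (rule bilinear_mapD(5)[OF assms(1)])
  have "(\<lambda>x y. f x y - g x y) = f + fun_scale (fun_scale sC) (- 1) g"
    by (simp add: fun_eq_iff fun_scale_def)
  then show ?thesis
    using assms by (simp add: bilinear_map_plus bilinear_map_fun_scale)
qed


section \<open>Subspaces and quotient spaces\<close>

lemma vector_space_fun_scale:
  assumes "vector_space sc"
  shows "vector_space (fun_scale sc)"
  using assms by (simp add: vector_space_def fun_scale_def fun_eq_iff)

lemma vector_space_pair_scale:
  assumes "vector_space sa" "vector_space sb"
  shows "vector_space (pair_scale sa sb)"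
  using assms by (simp add: vector_space_def pair_scale_def split_def prod_eq_iff)

section \<open>Quotients of one subspace by another\<close>

definition cong_rel :: "'a::ab_group_add set \<Rightarrow> 'a set \<Rightarrow> 'a rel" where
  "cong_rel Z B = {(a, b). a \<in> Z \<and> b \<in> Z \<and> a - b \<in> B}"

text \<open>The operations range over all representatives, exactly as in \<open>H2_FGV\<close>, so
  that the cohomology space is literally an instance. Each union collapses to one class once
  independence of representatives is known.\<close>

definition quotient_vspace ::
  "('k \<Rightarrow> 'a \<Rightarrow> 'a) \<Rightarrow> 'a::ab_group_add set \<Rightarrow> 'a rel \<Rightarrow> ('k, 'a set) vspace" where
  "quotient_vspace sc Z R =
     \<lparr>vcarrier = Z // R,
      vadd = (\<lambda>X Y. \<Union>a\<in>X. \<Union>b\<in>Y. R `` {a + b}),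
      vzero = R `` {0},
      vscale = (\<lambda>c X. \<Union>a\<in>X. R `` {sc c a})\<rparr>"

context vector_space
begin

lemma vspace_sub_vspace:
  assumes "subspace S"
  shows "vspace (sub_vspace S scale)"
proof
  fix x assume "x \<in> vcarrier (sub_vspace S scale)"
  then show "\<exists>y\<in>vcarrier (sub_vspace S scale).
      vadd (sub_vspace S scale) x y = vzero (sub_vspace S scale)"
    using subspace_neg[OF assms, of x] by (auto simp: sub_vspace_def intro!: bexI[of _ "- x"])
qed (use assms in \<open>auto simp: sub_vspace_def subspace_def algebra_simps\<close>)

context
  fixes Z B R
  assumes Z: "subspace Z" and B: "subspace B" and R: "R = cong_rel Z B"
begin

lemma equiv_cong_rel: "equiv Z R"
proof (rule equivI)
  show "R \<subseteq> Z \<times> Z" "refl_on Z R"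
    using subspace_0[OF B] by (auto simp: R cong_rel_def refl_on_def)
  show "sym R"
  proof (rule symI)
    fix a b assume "(a, b) \<in> R"
    then show "(b, a) \<in> R"
      using subspace_neg[OF B, of "a - b"] by (simp add: R cong_rel_def)
  qed
  show "trans R"
  proof (rule transI)
    fix a b c assume "(a, b) \<in> R" "(b, c) \<in> R"
    then show "(a, c) \<in> R"
      using subspace_add[OF B, of "a - b" "b - c"] by (simp add: R cong_rel_def)
  qed
qed

lemma cong_rel_class_eq_iff:
  assumes "a \<in> Z" "b \<in> Z"
  shows "R `` {a} = R `` {b} \<longleftrightarrow> a - b \<in> B"
  using eq_equiv_class_iff[OF equiv_cong_rel assms] assms by (simp add: R cong_rel_def)

text \<open>Replacing \<open>a\<close> and \<open>b\<close> by congruent elements changes their sum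
  by an element of \<open>B\<close>, so the union defining the sum of two classes is a union of
  copies of one class.\<close>

lemma quotient_vspace_add:
  assumes "a \<in> Z" "b \<in> Z"
  shows "vadd (quotient_vspace scale Z R) (R `` {a}) (R `` {b}) = R `` {a + b}"
proof -
  have "R `` {a' + b'} = R `` {a + b}" if "(a, a') \<in> R" "(b, b') \<in> R" for a' b'
  proof -
    have *: "a' \<in> Z" "b' \<in> Z" "a - a' \<in> B" "b - b' \<in> B"
      using that by (simp_all add: R cong_rel_def)
    have "a + b - (a' + b') \<in> B"
      using subspace_add[OF B *(3,4)] by (simp add: algebra_simps)
    then show ?thesis
      using cong_rel_class_eq_iff[of "a + b" "a' + b'"] * assms subspace_add[OF Z] by simp
  qed
  then have "vadd (quotient_vspace scale Z R) (R `` {a}) (R `` {b}) =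
      (\<Union>a'\<in>R `` {a}. \<Union>b'\<in>R `` {b}. R `` {a + b})"
    by (simp add: quotient_vspace_def)
  \<comment> \<open>The index sets are nonempty; otherwise the union of equal classes would be empty
    instead of that class.\<close>
  moreover have "a \<in> R `` {a}" "b \<in> R `` {b}"
    using assms subspace_0[OF B] by (simp_all add: R cong_rel_def)
  ultimately show ?thesis
    by blast
qed

lemma quotient_vspace_scale:
  assumes "a \<in> Z"
  shows "vscale (quotient_vspace scale Z R) c (R `` {a}) = R `` {scale c a}"
proof -
  have "R `` {scale c a'} = R `` {scale c a}" if "(a, a') \<in> R" for a'
  proof -
    have *: "a' \<in> Z" "a - a' \<in> B"
      using that by (simp_all add: R cong_rel_def)
    have "scale c a - scale c a' \<in> B"
      using subspace_scale[OF B *(2), of c] by (simp add: scale_right_diff_distrib)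
    then show ?thesis
      using cong_rel_class_eq_iff[of "scale c a" "scale c a'"] * assms subspace_scale[OF Z] by simp
  qed
  then have "vscale (quotient_vspace scale Z R) c (R `` {a}) = (\<Union>a'\<in>R `` {a}. R `` {scale c a})"
    by (simp add: quotient_vspace_def)
  moreover have "a \<in> R `` {a}"
    using assms subspace_0[OF B] by (simp add: R cong_rel_def)
  ultimately show ?thesis
    by blast
qed

lemma vspace_quotient_vspace: "vspace (quotient_vspace scale Z R)"
proof -
  have [simp]: "vcarrier (quotient_vspace scale Z R) = Z // R"
    "vzero (quotient_vspace scale Z R) = R `` {0}"
    by (simp_all add: quotient_vspace_def)
  note [simp] = quotient_vspace_add quotient_vspace_scale subspace_0[OF Z] subspace_add[OF Z]
    subspace_scale[OF Z] subspace_neg[OF Z]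
  show ?thesis
  proof
    fix X assume "X \<in> vcarrier (quotient_vspace scale Z R)"
    then obtain a where "a \<in> Z" "X = R `` {a}"
      by (auto elim: quotientE)
    then show "\<exists>Y\<in>vcarrier (quotient_vspace scale Z R).
        vadd (quotient_vspace scale Z R) X Y = vzero (quotient_vspace scale Z R)"
      by (auto intro!: bexI[of _ "R `` {- a}"] quotientI)
  qed (auto elim!: quotientE intro!: quotientI simp: algebra_simps)
qed

end

end


section \<open>Cohomology classes and compatible pairs\<close>

text \<open>The differentials of linear maps from \<open>P\<close> to \<open>V\<close>. Separating
  this set from \<open>cohomologous\<close> exhibits cohomology as a quotient by a subspace.\<close>

definition coboundaries2 ::
  "('k::field, 'p::ab_group_add) poisson \<Rightarrow> ('k \<Rightarrow> 'v::ab_group_add \<Rightarrow> 'v) \<Rightarrow>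
   ('p \<Rightarrow> 'v \<Rightarrow> 'v) \<Rightarrow> ('p \<Rightarrow> 'v \<Rightarrow> 'v) \<Rightarrow> ('p, 'v) cochain2 set" where
  "coboundaries2 P sV \<mu> \<rho> = {(h, H). \<exists>\<phi>. Vector_Spaces.linear (pscale P) sV \<phi> \<and>
     (\<forall>x y. h x y = \<mu> x (\<phi> y) - \<phi> (x \<odot>\<^bsub>P\<^esub> y) + \<mu> y (\<phi> x)) \<and>
     (\<forall>x y. H x y = \<rho> x (\<phi> y) - \<phi> \<lbrace>x, y\<rbrace>\<^bsub>P\<^esub> - \<rho> y (\<phi> x))}"

sublocale poisson_algebra \<subseteq> VP: vector_space "pscale P"
  by (rule vector_space)

context poisson_algebra
begin

lemmas mult_simps = bilinear_map_simps[OF mult_bilinear]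
lemmas brk_simps = bilinear_map_simps[OF brk_bilinear]

lemma brk_skew: "\<lbrace>x, y\<rbrace> = - \<lbrace>y, x\<rbrace>"
proof -
  have "\<lbrace>x + y, x + y\<rbrace> = \<lbrace>x, y\<rbrace> + \<lbrace>y, x\<rbrace>"
    using brk_self[of x] brk_self[of y] by (simp only: brk_simps) simp
  then show ?thesis
    using brk_self[of "x + y"] by (simp add: eq_neg_iff_add_eq_0)
qed

lemma poisson_Der_subspace:
  "module.subspace (fun_scale (pscale P)) (poisson_Der P)"
proof -
  interpret F: vector_space "fun_scale (pscale P) :: _ \<Rightarrow> (_ \<Rightarrow> _) \<Rightarrow> _"
    by (rule vector_space_fun_scale[OF vector_space])
  show ?thesis
  proof (rule F.subspaceI)
    show "0 \<in> poisson_Der P"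
      by (simp add: poisson_Der_def linear_zero vector_space mult_simps brk_simps)
  next
    fix d d' assume "d \<in> poisson_Der P" "d' \<in> poisson_Der P"
    then show "d + d' \<in> poisson_Der P"
      by (simp add: poisson_Der_def linear_plus mult_simps brk_simps add_ac)
  next
    fix c d assume "d \<in> poisson_Der P"
    then show "fun_scale (pscale P) c d \<in> poisson_Der P"
      by (simp add: poisson_Der_def linear_fun_scale)
        (simp add: fun_scale_def mult_simps brk_simps VP.scale_right_distrib)
  qed
qed

end

sublocale poisson_rep \<subseteq> VV: vector_space sV
  by (rule bilinear_mapD(5)[OF mu_bilinear])

context poisson_rep
begin

lemmas mu_simps = bilinear_map_simps[OF mu_bilinear]
lemmas rho_simps = bilinear_map_simps[OF rho_bilinear]

section \<open>Cochains, cocycles, coboundaries and the second cohomology space\<close>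

abbreviation cochain_scale :: "'k \<Rightarrow> ('p, 'v) cochain2 \<Rightarrow> ('p, 'v) cochain2" where
  "cochain_scale \<equiv> pair_scale (fun_scale (fun_scale sV)) (fun_scale (fun_scale sV))"

sublocale Coch: vector_space cochain_scale
  by (intro vector_space_pair_scale vector_space_fun_scale VV.vector_space_axioms)

text \<open>The cocycle identities are solved for one term each, so that their instances can serve as
  rewrite rules.\<close>

lemma cocycles2_iff:
  "(h, H) \<in> cocycles2 P sV \<mu> \<rho> \<longleftrightarrow>
     bilinear_map (pscale P) (pscale P) sV h \<and> (\<forall>x y. h x y = h y x) \<and>
     bilinear_map (pscale P) (pscale P) sV H \<and> (\<forall>x y. H x y = - H y x) \<and>
     (\<forall>x y z. h (x \<odot> y) z = \<mu> x (h y z) + h x (y \<odot> z) - \<mu> z (h x y)) \<and>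
     (\<forall>x y z. H x \<lbrace>y, z\<rbrace> = - (\<rho> x (H y z) + \<rho> y (H z x) + \<rho> z (H x y)
        + H y \<lbrace>z, x\<rbrace> + H z \<lbrace>x, y\<rbrace>)) \<and>
     (\<forall>x y z. H x (y \<odot> z) = \<mu> y (H x z) + \<mu> z (H x y) + h \<lbrace>x, y\<rbrace> z + h y \<lbrace>x, z\<rbrace> - \<rho> x (h y z))"
proof -
  have 1: "a - b + c - d = 0 \<longleftrightarrow> b = a + c - d" for a b c d :: 'v
    by (auto simp: algebra_simps)
  have 2: "a + b + c + d + e + f = 0 \<longleftrightarrow> d = - (a + b + c + e + f)" for a b c d e f :: 'v
    by (auto simp: algebra_simps eq_neg_iff_add_eq_0)
  have 3: "a - b - c + d - e - f = 0 \<longleftrightarrow> d = e + f + b + c - a" for a b c d e f :: 'v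
    by (auto simp: algebra_simps)
  show ?thesis
    unfolding cocycles2_def mem_Collect_eq prod.case 1 2 3 by (rule refl)
qed

lemma cocycles2D:
  assumes "(h, H) \<in> cocycles2 P sV \<mu> \<rho>"
  shows "bilinear_map (pscale P) (pscale P) sV h" "bilinear_map (pscale P) (pscale P) sV H"
    "h x y = h y x" "H x y = - H y x"
    "h (x \<odot> y) z = \<mu> x (h y z) + h x (y \<odot> z) - \<mu> z (h x y)"
    "H x \<lbrace>y, z\<rbrace> = - (\<rho> x (H y z) + \<rho> y (H z x) + \<rho> z (H x y) + H y \<lbrace>z, x\<rbrace> + H z \<lbrace>x, y\<rbrace>)"
    "H x (y \<odot> z) = \<mu> y (H x z) + \<mu> z (H x y) + h \<lbrace>x, y\<rbrace> z + h y \<lbrace>x, z\<rbrace> - \<rho> x (h y z)"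
  using assms unfolding cocycles2_iff by blast+

lemma cocycles2I:
  assumes "bilinear_map (pscale P) (pscale P) sV h" "bilinear_map (pscale P) (pscale P) sV H"
    and "\<And>x y. h x y = h y x" "\<And>x y. H x y = - H y x"
    and "\<And>x y z. h (x \<odot> y) z = \<mu> x (h y z) + h x (y \<odot> z) - \<mu> z (h x y)"
    and "\<And>x y z. H x \<lbrace>y, z\<rbrace> =
      - (\<rho> x (H y z) + \<rho> y (H z x) + \<rho> z (H x y) + H y \<lbrace>z, x\<rbrace> + H z \<lbrace>x, y\<rbrace>)"
    and "\<And>x y z. H x (y \<odot> z) =
      \<mu> y (H x z) + \<mu> z (H x y) + h \<lbrace>x, y\<rbrace> z + h y \<lbrace>x, z\<rbrace> - \<rho> x (h y z)"
  shows "(h, H) \<in> cocycles2 P sV \<mu> \<rho>"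
  using assms unfolding cocycles2_iff by blast

lemma cocycles2_subspace: "Coch.subspace (cocycles2 P sV \<mu> \<rho>)"
proof (rule Coch.subspaceI)
  show "0 \<in> cocycles2 P sV \<mu> \<rho>"
    by (simp add: zero_prod_def cocycles2_iff bilinear_map_zero vector_space
        VV.vector_space_axioms mu_simps rho_simps)
next
  fix a b assume "a \<in> cocycles2 P sV \<mu> \<rho>" "b \<in> cocycles2 P sV \<mu> \<rho>"
  moreover obtain h H h' H' where ab: "a = (h, H)" "b = (h', H')"
    by fastforce
  ultimately have a: "(h, H) \<in> cocycles2 P sV \<mu> \<rho>" and b: "(h', H') \<in> cocycles2 P sV \<mu> \<rho>"
    by simp_all
  have "(h + h', H + H') \<in> cocycles2 P sV \<mu> \<rho>"
  proof (rule cocycles2I)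
    fix x y z
    show "(h + h') x y = (h + h') y x" "(H + H') x y = - (H + H') y x"
      using cocycles2D(3,4)[OF a, of x y] cocycles2D(3,4)[OF b, of x y] by simp_all
    show "(h + h') (x \<odot> y) z = \<mu> x ((h + h') y z) + (h + h') x (y \<odot> z) - \<mu> z ((h + h') x y)"
      by (simp add: cocycles2D(5)[OF a, of x y z] cocycles2D(5)[OF b, of x y z] mu_simps)
    show "(H + H') x \<lbrace>y, z\<rbrace> = - (\<rho> x ((H + H') y z) + \<rho> y ((H + H') z x) + \<rho> z ((H + H') x y)
        + (H + H') y \<lbrace>z, x\<rbrace> + (H + H') z \<lbrace>x, y\<rbrace>)"
      by (simp add: cocycles2D(6)[OF a, of x y z] cocycles2D(6)[OF b, of x y z] rho_simps)
    show "(H + H') x (y \<odot> z) = \<mu> y ((H + H') x z) + \<mu> z ((H + H') x y) + (h + h') \<lbrace>x, y\<rbrace> z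
        + (h + h') y \<lbrace>x, z\<rbrace> - \<rho> x ((h + h') y z)"
      by (simp add: cocycles2D(7)[OF a, of x y z] cocycles2D(7)[OF b, of x y z]
          mu_simps rho_simps)
  qed (use cocycles2D(1,2)[OF a] cocycles2D(1,2)[OF b] in \<open>simp_all add: bilinear_map_plus\<close>)
  then show "a + b \<in> cocycles2 P sV \<mu> \<rho>"
    by (simp add: ab plus_prod_def)
next
  fix c a assume "a \<in> cocycles2 P sV \<mu> \<rho>"
  moreover obtain h H where a_eq: "a = (h, H)"
    by fastforce
  ultimately have a: "(h, H) \<in> cocycles2 P sV \<mu> \<rho>"
    by simp
  let ?c = "fun_scale (fun_scale sV) c :: ('p \<Rightarrow> 'p \<Rightarrow> 'v) \<Rightarrow> _"
  note [simp] = fun_scale_def VV.scale_right_distrib VV.scale_right_diff_distrib mu_simps rho_simps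
  have "(?c h, ?c H) \<in> cocycles2 P sV \<mu> \<rho>"
  proof (rule cocycles2I)
    show "bilinear_map (pscale P) (pscale P) sV (?c h)" "bilinear_map (pscale P) (pscale P) sV (?c H)"
      using cocycles2D(1,2)[OF a] by (simp_all only: bilinear_map_fun_scale)
  next
    fix x y z
    show "?c h x y = ?c h y x" "?c H x y = - ?c H y x"
      using cocycles2D(3,4)[OF a, of x y] by simp_all
    show "?c h (x \<odot> y) z = \<mu> x (?c h y z) + ?c h x (y \<odot> z) - \<mu> z (?c h x y)"
      by (simp add: cocycles2D(5)[OF a, of x y z])
    show "?c H x \<lbrace>y, z\<rbrace> = - (\<rho> x (?c H y z) + \<rho> y (?c H z x) + \<rho> z (?c H x y)
        + ?c H y \<lbrace>z, x\<rbrace> + ?c H z \<lbrace>x, y\<rbrace>)"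
      by (simp add: cocycles2D(6)[OF a, of x y z])
    show "?c H x (y \<odot> z) = \<mu> y (?c H x z) + \<mu> z (?c H x y) + ?c h \<lbrace>x, y\<rbrace> z
        + ?c h y \<lbrace>x, z\<rbrace> - \<rho> x (?c h y z)"
      by (simp add: cocycles2D(7)[OF a, of x y z])
  qed
  then show "cochain_scale c a \<in> cocycles2 P sV \<mu> \<rho>"
    by (simp add: a_eq pair_scale_def del: fun_scale_def)
qed

text \<open>The differential is linear in \<open>\<phi>\<close>, so sums and multiples of
  coboundaries come from sums and multiples of the maps \<open>\<phi>\<close>.\<close>

lemma coboundaries2_subspace: "Coch.subspace (coboundaries2 P sV \<mu> \<rho>)"
proof (rule Coch.subspaceI)
  show "0 \<in> coboundaries2 P sV \<mu> \<rho>"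
    by (auto simp: coboundaries2_def zero_prod_def mu_simps rho_simps
        intro!: exI[of _ 0] linear_zero vector_space VV.vector_space_axioms)
next
  fix a b assume "a \<in> coboundaries2 P sV \<mu> \<rho>" "b \<in> coboundaries2 P sV \<mu> \<rho>"
  then obtain h H \<phi> h' H' \<phi>' where ab: "a = (h, H)" "b = (h', H')"
    and *: "Vector_Spaces.linear (pscale P) sV \<phi>" "Vector_Spaces.linear (pscale P) sV \<phi>'"
      "\<And>x y. h x y = \<mu> x (\<phi> y) - \<phi> (x \<odot> y) + \<mu> y (\<phi> x)"
      "\<And>x y. H x y = \<rho> x (\<phi> y) - \<phi> \<lbrace>x, y\<rbrace> - \<rho> y (\<phi> x)"
      "\<And>x y. h' x y = \<mu> x (\<phi>' y) - \<phi>' (x \<odot> y) + \<mu> y (\<phi>' x)"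
      "\<And>x y. H' x y = \<rho> x (\<phi>' y) - \<phi>' \<lbrace>x, y\<rbrace> - \<rho> y (\<phi>' x)"
    by (auto simp: coboundaries2_def)
  then show "a + b \<in> coboundaries2 P sV \<mu> \<rho>"
    by (auto simp: coboundaries2_def mu_simps rho_simps intro!: exI[of _ "\<phi> + \<phi>'"] linear_plus)
next
  fix c a assume "a \<in> coboundaries2 P sV \<mu> \<rho>"
  then obtain h H \<phi> where "a = (h, H)" "Vector_Spaces.linear (pscale P) sV \<phi>"
      "\<And>x y. h x y = \<mu> x (\<phi> y) - \<phi> (x \<odot> y) + \<mu> y (\<phi> x)"
      "\<And>x y. H x y = \<rho> x (\<phi> y) - \<phi> \<lbrace>x, y\<rbrace> - \<rho> y (\<phi> x)"
    by (auto simp: coboundaries2_def)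
  then show "cochain_scale c a \<in> coboundaries2 P sV \<mu> \<rho>"
    by (auto simp: coboundaries2_def pair_scale_def fun_scale_def mu_simps rho_simps
        VV.scale_right_distrib VV.scale_right_diff_distrib
        intro!: exI[of _ "fun_scale sV c \<phi>"] linear_fun_scale[unfolded fun_scale_def])
qed

text \<open>Cohomology becomes congruence modulo a subspace, so that the equivalence relation, the
  well-defined operations and the vector space laws all come from the general quotient
  construction.\<close>

lemma cohomologous_eq:
  "cohomologous P sV \<mu> \<rho> = cong_rel (cocycles2 P sV \<mu> \<rho>) (coboundaries2 P sV \<mu> \<rho>)"
  by (rule set_eqI) (simp add: cohomologous_def cong_rel_def coboundaries2_def split_def)

lemma H2_FGV_eq:
  "H2_FGV P sV \<mu> \<rho> =
     quotient_vspace cochain_scale (cocycles2 P sV \<mu> \<rho>) (cohomologous P sV \<mu> \<rho>)"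
  by (simp add: H2_FGV_def quotient_vspace_def coho_class_def)

lemmas vspace_H2_FGV =
  Coch.vspace_quotient_vspace[OF cocycles2_subspace coboundaries2_subspace cohomologous_eq,
    folded H2_FGV_eq]
lemmas coho_class_add =
  Coch.quotient_vspace_add[OF cocycles2_subspace coboundaries2_subspace cohomologous_eq,
    folded H2_FGV_eq coho_class_def]
lemmas coho_class_scale =
  Coch.quotient_vspace_scale[OF cocycles2_subspace coboundaries2_subspace cohomologous_eq,
    folded H2_FGV_eq coho_class_def]
lemmas coho_class_eq_iff =
  Coch.cong_rel_class_eq_iff[OF cocycles2_subspace coboundaries2_subspace cohomologous_eq,
    folded coho_class_def]

text \<open>The zero class is the class of the zero cochain, so being congruent to it means being a
  coboundary. This turns vanishing of a Wells class into existence of some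
  \<open>\<phi>\<close>.\<close>

lemma coho_class_eq_zero_iff:
  assumes "c \<in> cocycles2 P sV \<mu> \<rho>"
  shows "coho_class P sV \<mu> \<rho> c = vzero (H2_FGV P sV \<mu> \<rho>) \<longleftrightarrow> c \<in> coboundaries2 P sV \<mu> \<rho>"
  using coho_class_eq_iff[OF assms Coch.subspace_0[OF cocycles2_subspace]]
  by (simp add: H2_FGV_def)

section \<open>The spaces of derivations from P to V and of compatible pairs\<close>

lemma vspace_Der_rep: "vspace (Der_rep P sV \<mu> \<rho>)"
proof -
  interpret F: vector_space "fun_scale sV :: _ \<Rightarrow> ('p \<Rightarrow> 'v) \<Rightarrow> _"
    by (rule vector_space_fun_scale[OF VV.vector_space_axioms])
  show ?thesis
    unfolding Der_rep_def
  proof (rule F.vspace_sub_vspace, rule F.subspaceI, goal_cases)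
    case 1
    then show ?case
      by (simp add: linear_zero vector_space VV.vector_space_axioms mu_simps rho_simps)
  next
    case 2
    then show ?case
      by (simp add: linear_plus mu_simps rho_simps algebra_simps)
  next
    case 3
    then show ?case
      by (simp add: linear_fun_scale)
        (simp add: fun_scale_def mu_simps rho_simps VV.scale_right_distrib
          VV.scale_right_diff_distrib)
  qed
qed

text \<open>With zero product and bracket, both Leibniz rules reduce to \<open>d 0 = 0\<close>,
  which linearity provides.\<close>

lemma poisson_Der_trivial:
  "poisson_Der (trivial_poisson sV) = {d. Vector_Spaces.linear sV sV d}"
  by (auto simp: poisson_Der_def trivial_poisson_def linear_simps)

lemma vspace_compat_Der: "vspace (compat_Der P sV \<mu> \<rho>)"
proof -
  interpret F: vector_space "pair_scale (fun_scale sV) (fun_scale (pscale P)) ::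
      _ \<Rightarrow> ('v \<Rightarrow> 'v) \<times> (_ \<Rightarrow> _) \<Rightarrow> _"
    by (intro vector_space_pair_scale vector_space_fun_scale VV.vector_space_axioms vector_space)
  interpret D: vector_space "fun_scale (pscale P) :: _ \<Rightarrow> (_ \<Rightarrow> _) \<Rightarrow> _"
    by (rule vector_space_fun_scale[OF vector_space])
  note D = D.subspace_0[OF poisson_Der_subspace] D.subspace_add[OF poisson_Der_subspace]
    D.subspace_scale[OF poisson_Der_subspace]
  show ?thesis
    unfolding compat_Der_def poisson_Der_trivial
  proof (rule F.vspace_sub_vspace, rule F.subspaceI, goal_cases)
    case 1
    then show ?case
      by (simp add: zero_prod_def linear_zero VV.vector_space_axioms mu_simps rho_simps D)
  next
    case 2
    then show ?case
      by (auto simp: linear_plus mu_simps rho_simps D algebra_simps)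
  next
    case 3
    then show ?case
      by (auto simp: pair_scale_def linear_fun_scale D)
        (auto simp: fun_scale_def mu_simps rho_simps VV.scale_right_distrib)
  qed
qed

lemma compat_Der_iff:
  "(dV, dP) \<in> vcarrier (compat_Der P sV \<mu> \<rho>) \<longleftrightarrow>
     Vector_Spaces.linear sV sV dV \<and> dP \<in> poisson_Der P \<and>
     (\<forall>x v. dV (\<mu> x v) = \<mu> (dP x) v + \<mu> x (dV v)) \<and>
     (\<forall>x v. dV (\<rho> x v) = \<rho> (dP x) v + \<rho> x (dV v))"
  unfolding compat_Der_def poisson_Der_trivial by (simp add: sub_vspace_def)

lemma compat_DerD:
  assumes "(dV, dP) \<in> vcarrier (compat_Der P sV \<mu> \<rho>)"
  shows "Vector_Spaces.linear sV sV dV" "Vector_Spaces.linear (pscale P) (pscale P) dP"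
    "dP (x \<odot> y) = dP x \<odot> y + x \<odot> dP y" "dP \<lbrace>x, y\<rbrace> = \<lbrace>dP x, y\<rbrace> + \<lbrace>x, dP y\<rbrace>"
    "dV (\<mu> x v) = \<mu> (dP x) v + \<mu> x (dV v)" "dV (\<rho> x v) = \<rho> (dP x) v + \<rho> x (dV v)"
  using assms by (simp_all add: compat_Der_iff poisson_Der_def)

text \<open>A compatible pair acts on cochains as an infinitesimal automorphism, and compatibility
  makes this action respect the cocycle equations: each deformed identity at \<open>x\<close>,
  \<open>y\<close>, \<open>z\<close> is \<open>dV\<close> of the original one minus the three
  originals with \<open>dP\<close> applied to one argument.\<close>

lemma deform_cocycles2:
  assumes d: "d \<in> vcarrier (compat_Der P sV \<mu> \<rho>)" and c: "(h, H) \<in> cocycles2 P sV \<mu> \<rho>"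
  shows "(deform d h, deform d H) \<in> cocycles2 P sV \<mu> \<rho>"
proof -
  obtain dV dP where d_eq: "d = (dV, dP)"
    by fastforce
  note d' = compat_DerD[OF d[unfolded d_eq]]
  note c' = cocycles2D[OF c]
  have deform: "deform d f = (\<lambda>x y. dV (f x y) - f (dP x) y - f x (dP y))" for f
    by (simp add: deform_def d_eq)
  have bil: "bilinear_map (pscale P) (pscale P) sV (deform d f)"
    if "bilinear_map (pscale P) (pscale P) sV f" for f
    unfolding deform using that d'(1,2)
    by (intro bilinear_map_diff bilinear_map_postcompose[of _ _ sV f sV dV]
        bilinear_map_precompose[where f = f and g = dP]
        bilinear_map_precompose'[where f = f and g = dP])
  note simps = deform d'(3-6) linear_simps[OF d'(1)] mu_simps rho_simps
    bilinear_map_simps[OF c'(1)] bilinear_map_simps[OF c'(2)]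
  show ?thesis
  proof (rule cocycles2I)
    fix x y z
    show "deform d h x y = deform d h y x"
      by (simp add: deform c'(3)[of x y] c'(3)[of "dP x" y] c'(3)[of x "dP y"])
    show "deform d H x y = - deform d H y x"
      by (simp add: simps c'(4)[of x y] c'(4)[of "dP x" y] c'(4)[of x "dP y"])
    show "deform d h (x \<odot> y) z =
        \<mu> x (deform d h y z) + deform d h x (y \<odot> z) - \<mu> z (deform d h x y)"
      by (simp add: simps c'(5)[of x y z] c'(5)[of "dP x" y z] c'(5)[of x "dP y" z]
          c'(5)[of x y "dP z"] algebra_simps)
    show "deform d H x \<lbrace>y, z\<rbrace> = - (\<rho> x (deform d H y z) + \<rho> y (deform d H z x)
        + \<rho> z (deform d H x y) + deform d H y \<lbrace>z, x\<rbrace> + deform d H z \<lbrace>x, y\<rbrace>)"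
      by (simp add: simps c'(6)[of x y z] c'(6)[of "dP x" y z] c'(6)[of x "dP y" z]
          c'(6)[of x y "dP z"] algebra_simps)
    show "deform d H x (y \<odot> z) = \<mu> y (deform d H x z) + \<mu> z (deform d H x y)
        + deform d h \<lbrace>x, y\<rbrace> z + deform d h y \<lbrace>x, z\<rbrace> - \<rho> x (deform d h y z)"
      by (simp add: simps c'(7)[of x y z] c'(7)[of "dP x" y z] c'(7)[of x "dP y" z]
          c'(7)[of x y "dP z"] algebra_simps)
  qed (use bil c'(1,2) in auto)
qed

end

section \<open>Abelian extensions in coordinates\<close>

text \<open>One section is fixed so that its coordinates can be named. As it is an arbitrary linear
  section, the result covers every choice of \<open>s\<close> in the maps \<open>eta_map\<close> and
  \<open>wells_map\<close>.\<close>

locale sectioned_extension = abelian_extension P sV \<mu> \<rho> E i p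
  for P :: "('k::field, 'p::ab_group_add) poisson"
    and sV :: "'k \<Rightarrow> 'v::ab_group_add \<Rightarrow> 'v"
    and \<mu> \<rho> :: "'p \<Rightarrow> 'v \<Rightarrow> 'v"
    and E :: "('k, 'e::ab_group_add) poisson"
    and i :: "'v \<Rightarrow> 'e"
    and p :: "'e \<Rightarrow> 'p" +
  fixes s :: "'p \<Rightarrow> 'e"
  assumes linear_section: "linear_section P E p s"
begin

sublocale E: poisson_algebra E
  by (rule E)

lemma linear_i: "Vector_Spaces.linear sV (pscale E) i"
  using i_hom by (simp add: poisson_hom_def trivial_poisson_def)

lemma linear_p: "Vector_Spaces.linear (pscale E) (pscale P) p"
  using p_hom by (simp add: poisson_hom_def)

lemma linear_s: "Vector_Spaces.linear (pscale P) (pscale E) s"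
  using linear_section by (simp add: linear_section_def)

lemmas i_simps = linear_simps[OF linear_i]
lemmas p_simps = linear_simps[OF linear_p]
lemmas s_simps = linear_simps[OF linear_s]

lemma p_s [simp]: "p (s x) = x"
  using linear_section by (simp add: linear_section_def fun_eq_iff)

lemma p_i [simp]: "p (i v) = 0"
  using range_i by blast

lemma inv_i [simp]: "inv i (i v) = v"
  by (rule inv_f_f[OF i_inj])

lemma i_inv: "p e = 0 \<Longrightarrow> i (inv i e) = e"
  using range_i by (intro f_inv_into_f) blast

lemma i_eq_iff [simp]: "i v = i w \<longleftrightarrow> v = w"
  by (rule inj_eq[OF i_inj])

lemma p_mult: "p (a \<odot>\<^bsub>E\<^esub> b) = p a \<odot>\<^bsub>P\<^esub> p b" and p_brk: "p \<lbrace>a, b\<rbrace>\<^bsub>E\<^esub> = \<lbrace>p a, p b\<rbrace>\<^bsub>P\<^esub>"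
  using p_hom by (simp_all add: poisson_hom_def)

lemma i_mult_i: "i v \<odot>\<^bsub>E\<^esub> i w = 0" and i_brk_i: "\<lbrace>i v, i w\<rbrace>\<^bsub>E\<^esub> = 0"
  using i_hom by (auto simp: poisson_hom_def trivial_poisson_def i_simps)

definition h :: "'p \<Rightarrow> 'p \<Rightarrow> 'v" where "h = fst (section_cocycle P E i s)"
definition H :: "'p \<Rightarrow> 'p \<Rightarrow> 'v" where "H = snd (section_cocycle P E i s)"

lemma section_cocycle: "section_cocycle P E i s = (h, H)"
  by (simp add: h_def H_def)

text \<open>The projection of \<open>E\<close> onto \<open>V\<close> along the image of
  \<open>s\<close>. The argument of \<open>inv i\<close> lies in the kernel of \<open>p\<close>,
  hence in \<open>range i\<close>, where \<open>inv i\<close> is meaningful.\<close>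

definition retr :: "'e \<Rightarrow> 'v" where
  "retr e = inv i (e - s (p e))"

lemma i_retr: "i (retr e) = e - s (p e)"
  by (simp add: retr_def i_inv p_simps)

lemma coord: "s (p e) + i (retr e) = e"
  by (simp add: i_retr)

lemma p_coord [simp]: "p (s x + i v) = x"
  by (simp add: p_simps)

lemma retr_coord [simp]: "retr (s x + i v) = v"
  by (simp add: retr_def p_simps)

lemma coord_eq_iff: "s x + i v = s y + i w \<longleftrightarrow> x = y \<and> v = w"
  by (metis p_coord retr_coord)

lemma coord_add: "(s x + i v) + (s y + i w) = s (x + y) + i (v + w)"
  by (simp add: s_simps i_simps)

lemma coord_scale: "pscale E c (s x + i v) = s (pscale P c x) + i (sV c v)"
  by (simp add: s_simps i_simps E.VP.scale_right_distrib)

text \<open>Addition and scaling in \<open>E\<close> act coordinatewise, and \<open>retr\<close>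
  reads off the second coordinate; \<open>coord\<close> folds the coordinates of \<open>a\<close>
  and \<open>b\<close> back into the elements themselves.\<close>

lemma linear_retr: "Vector_Spaces.linear (pscale E) sV retr"
proof -
  have "retr (a + b) = retr a + retr b" for a b
    using coord_add[of "p a" "retr a" "p b" "retr b"] retr_coord by (simp only: coord)
  moreover have "retr (pscale E c a) = sV c (retr a)" for a c
    using coord_scale[of c "p a" "retr a"] retr_coord by (simp only: coord)
  ultimately show ?thesis
    by (simp add: Vector_Spaces.linear_iff E.vector_space VV.vector_space_axioms)
qed

lemmas retr_simps = linear_simps[OF linear_retr]

lemma i_h: "i (h x y) = s x \<odot>\<^bsub>E\<^esub> s y - s (x \<odot>\<^bsub>P\<^esub> y)"
  and i_H: "i (H x y) = \<lbrace>s x, s y\<rbrace>\<^bsub>E\<^esub> - s \<lbrace>x, y\<rbrace>\<^bsub>P\<^esub>"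
  by (simp_all add: h_def H_def section_cocycle_def i_inv p_simps p_mult p_brk)

text \<open>Since \<open>p\<close> is a Poisson homomorphism, the correction term of the cocycle is
  exactly what \<open>retr\<close> subtracts. In this form \<open>h\<close> and \<open>H\<close> are
  visibly composites of linear and bilinear maps.\<close>

lemma h_eq: "h x y = retr (s x \<odot>\<^bsub>E\<^esub> s y)" and H_eq: "H x y = retr \<lbrace>s x, s y\<rbrace>\<^bsub>E\<^esub>"
  by (simp_all add: h_def H_def section_cocycle_def retr_def p_mult p_brk)

text \<open>Expanding gives four terms: the one on the image of \<open>s\<close> contributes
  \<open>h\<close>, the mixed ones are the action \<open>\<mu>\<close> by \<open>mu_section\<close>,
  and the product of two elements of \<open>V\<close> vanishes.\<close>

lemma coord_mult:
  "(s x + i v) \<odot>\<^bsub>E\<^esub> (s y + i w) = s (x \<odot>\<^bsub>P\<^esub> y) + i (h x y + \<mu> x w + \<mu> y v)"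
  using E.mult_commute[of "i v" "s y"]
  by (simp add: E.mult_simps i_simps i_mult_i i_h mu_section[OF linear_section])

text \<open>As for the product, except that the bracket of \<open>i v\<close> with
  \<open>s y\<close> must first be reversed to match \<open>rho_section\<close>, which produces the
  minus sign.\<close>

lemma coord_brk:
  "\<lbrace>s x + i v, s y + i w\<rbrace>\<^bsub>E\<^esub> = s \<lbrace>x, y\<rbrace>\<^bsub>P\<^esub> + i (H x y + \<rho> x w - \<rho> y v)"
  using E.brk_skew[of "i v" "s y"]
  by (simp add: E.brk_simps i_simps i_brk_i i_H rho_section[OF linear_section])

lemma bilinear_h: "bilinear_map (pscale P) (pscale P) sV h"
  unfolding h_eq[abs_def]
  by (rule bilinear_map_postcompose[OF bilinear_map_precompose'[OF
        bilinear_map_precompose[OF E.mult_bilinear linear_s] linear_s] linear_retr])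

lemma bilinear_H: "bilinear_map (pscale P) (pscale P) sV H"
  unfolding H_eq[abs_def]
  by (rule bilinear_map_postcompose[OF bilinear_map_precompose'[OF
        bilinear_map_precompose[OF E.brk_bilinear linear_s] linear_s] linear_retr])

lemmas h_simps = bilinear_map_simps[OF bilinear_h]
lemmas H_simps = bilinear_map_simps[OF bilinear_H]

text \<open>The cocycle identities are the \<open>V\<close>-coordinates of the axioms of \<open>E\<close> on the image of \<open>s\<close>.\<close>

lemma section_cocycle_in_cocycles2: "(h, H) \<in> cocycles2 P sV \<mu> \<rho>"
proof (rule cocycles2I[OF bilinear_h bilinear_H])
  fix x y z
  show "h x y = h y x"
    unfolding h_eq by (simp add: E.mult_commute[of "s x"])
  show "H x y = - H y x"
    unfolding H_eq by (subst E.brk_skew) (simp add: retr_simps)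
  show "h (x \<odot>\<^bsub>P\<^esub> y) z = \<mu> x (h y z) + h x (y \<odot>\<^bsub>P\<^esub> z) - \<mu> z (h x y)"
    \<comment> \<open>Elements of the image of \<open>s\<close> are written with a zero second
      coordinate, so that the coordinate formulas rewrite nested products as well.\<close>
    using E.mult_assoc[of "s x + i 0" "s y + i 0" "s z + i 0"]
    unfolding coord_mult coord_eq_iff by (simp add: mu_simps algebra_simps)
  show "H x \<lbrace>y, z\<rbrace>\<^bsub>P\<^esub> = - (\<rho> x (H y z) + \<rho> y (H z x) + \<rho> z (H x y)
      + H y \<lbrace>z, x\<rbrace>\<^bsub>P\<^esub> + H z \<lbrace>x, y\<rbrace>\<^bsub>P\<^esub>)"
    \<comment> \<open>The right-hand side of the Jacobi identity is \<open>0\<close>, which is not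
      in coordinate form; applying \<open>retr\<close> to both sides extracts the second
      coordinate.\<close>
    using arg_cong[OF E.jacobi[of "s x + i 0" "s y + i 0" "s z + i 0"], of retr]
    unfolding coord_brk coord_add retr_coord
    by (simp add: rho_simps retr_simps eq_neg_iff_add_eq_0 algebra_simps)
  show "H x (y \<odot>\<^bsub>P\<^esub> z) = \<mu> y (H x z) + \<mu> z (H x y) + h \<lbrace>x, y\<rbrace>\<^bsub>P\<^esub> z + h y \<lbrace>x, z\<rbrace>\<^bsub>P\<^esub> - \<rho> x (h y z)"
    using E.leibniz[of "s x + i 0" "s y + i 0" "s z + i 0"]
    unfolding coord_mult coord_brk coord_add coord_eq_iff
    by (simp add: mu_simps rho_simps algebra_simps)
qed

section \<open>Block triangular endomorphisms of E\<close>

definition assemble :: "('v \<Rightarrow> 'v) \<Rightarrow> ('p \<Rightarrow> 'p) \<Rightarrow> ('p \<Rightarrow> 'v) \<Rightarrow> 'e \<Rightarrow> 'e" where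
  "assemble dV dP \<phi> e = s (dP (p e)) + i (\<phi> (p e) + dV (retr e))"

lemma assemble_coord: "assemble dV dP \<phi> (s x + i v) = s (dP x) + i (\<phi> x + dV v)"
  by (simp add: assemble_def)

text \<open>The element \<open>i v\<close> has coordinates \<open>0\<close> and \<open>v\<close>.
  The values at \<open>0\<close> remain because the entries are arbitrary functions here; they
  vanish for linear entries.\<close>

lemma assemble_i: "assemble dV dP \<phi> (i v) = s (dP 0) + i (\<phi> 0 + dV v)"
  using assemble_coord[of dV dP \<phi> 0 v] by (simp add: s_simps)

lemma assemble_s: "assemble dV dP \<phi> (s x) = s (dP x) + i (\<phi> x + dV 0)"
  using assemble_coord[of dV dP \<phi> x 0] by (simp add: i_simps)

lemma linear_assemble:
  assumes "Vector_Spaces.linear sV sV dV" "Vector_Spaces.linear (pscale P) (pscale P) dP"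
    "Vector_Spaces.linear (pscale P) sV \<phi>"
  shows "Vector_Spaces.linear (pscale E) (pscale E) (assemble dV dP \<phi>)"
  unfolding Vector_Spaces.linear_iff
  by (simp add: E.vector_space assemble_def p_simps retr_simps linear_simps[OF assms(1)]
      linear_simps[OF assms(2)] linear_simps[OF assms(3)] s_simps i_simps
      E.VP.scale_right_distrib algebra_simps)

text \<open>Splitting \<open>e\<close> into coordinates, linearity reduces \<open>d e\<close> to the
  values of \<open>d\<close> on the images of \<open>s\<close> and \<open>i\<close>. Preserving
  \<open>V\<close> means that \<open>d (i v)\<close> has first coordinate \<open>0\<close>, so there
  is no entry from \<open>V\<close> to \<open>P\<close>.\<close>

lemma assemble_of_linear:
  assumes d: "Vector_Spaces.linear (pscale E) (pscale E) d" and V: "d ` range i \<subseteq> range i"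
  shows "d = assemble (\<lambda>v. retr (d (i v))) (\<lambda>x. p (d (s x))) (\<lambda>x. retr (d (s x)))"
proof
  fix e
  have "p (d (i v)) = 0" for v
    using V range_i by blast
  then have i: "i (retr (d (i v))) = d (i v)" for v
    by (simp add: i_retr s_simps)
  have "d e = d (s (p e)) + d (i (retr e))"
    by (simp only: coord flip: linear_simps(1)[OF d])
  also have "d (s (p e)) = s (p (d (s (p e)))) + i (retr (d (s (p e))))"
    by (simp only: coord)
  finally show "d e = assemble (\<lambda>v. retr (d (i v))) (\<lambda>x. p (d (s x))) (\<lambda>x. retr (d (s x))) e"
    by (simp add: assemble_def i_simps i)
qed

text \<open>The Leibniz rules are compared coordinatewise. The first coordinate says that
  \<open>dP\<close> is a derivation. The second one splits into the terms without \<open>v\<close>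
  and \<open>w\<close>, which equate the deformed cocycle with the differential of
  \<open>\<phi>\<close>, and the terms linear in \<open>v\<close> or \<open>w\<close>, which express
  compatibility with the representation.\<close>

lemma assemble_poisson_Der_iff:
  assumes dV: "Vector_Spaces.linear sV sV dV"
    and dP: "Vector_Spaces.linear (pscale P) (pscale P) dP"
    and \<phi>: "Vector_Spaces.linear (pscale P) sV \<phi>"
  shows "assemble dV dP \<phi> \<in> poisson_Der E \<longleftrightarrow>
    (dV, dP) \<in> vcarrier (compat_Der P sV \<mu> \<rho>) \<and>
    (\<forall>x y. deform (dV, dP) h x y = \<mu> x (\<phi> y) - \<phi> (x \<odot>\<^bsub>P\<^esub> y) + \<mu> y (\<phi> x)) \<and>
    (\<forall>x y. deform (dV, dP) H x y = \<rho> x (\<phi> y) - \<phi> \<lbrace>x, y\<rbrace>\<^bsub>P\<^esub> - \<rho> y (\<phi> x))"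
    (is "?d \<in> _ \<longleftrightarrow> ?rhs")
proof -
  note V_simps = linear_simps[OF dV] and P_simps = linear_simps[OF dP]
    and \<phi>_simps = linear_simps[OF \<phi>]
  have ex_coord: "(\<forall>e. Q e) \<longleftrightarrow> (\<forall>x v. Q (s x + i v))" for Q
    by (metis coord)
  have "?d \<in> poisson_Der E \<longleftrightarrow>
    (\<forall>x v y w. ?d ((s x + i v) \<odot>\<^bsub>E\<^esub> (s y + i w)) =
      ?d (s x + i v) \<odot>\<^bsub>E\<^esub> (s y + i w) + (s x + i v) \<odot>\<^bsub>E\<^esub> ?d (s y + i w)) \<and>
    (\<forall>x v y w. ?d \<lbrace>s x + i v, s y + i w\<rbrace>\<^bsub>E\<^esub> =
      \<lbrace>?d (s x + i v), s y + i w\<rbrace>\<^bsub>E\<^esub> + \<lbrace>s x + i v, ?d (s y + i w)\<rbrace>\<^bsub>E\<^esub>)"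
    \<comment> \<open>The four quantifiers over \<open>E\<close> in the two Leibniz rules become
      quantifiers over coordinates.\<close>
    unfolding poisson_Der_def mem_Collect_eq
    using linear_assemble[OF assms] by (subst (1 2 3 4) ex_coord) blast
  also have "\<dots> \<longleftrightarrow>
    (\<forall>x v y w. dP (x \<odot>\<^bsub>P\<^esub> y) = dP x \<odot>\<^bsub>P\<^esub> y + x \<odot>\<^bsub>P\<^esub> dP y \<and>
      \<phi> (x \<odot>\<^bsub>P\<^esub> y) + dV (h x y + \<mu> x w + \<mu> y v) =
        (h (dP x) y + \<mu> (dP x) w + \<mu> y (\<phi> x + dV v)) +
        (h x (dP y) + \<mu> x (\<phi> y + dV w) + \<mu> (dP y) v)) \<and>
    (\<forall>x v y w. dP \<lbrace>x, y\<rbrace>\<^bsub>P\<^esub> = \<lbrace>dP x, y\<rbrace>\<^bsub>P\<^esub> + \<lbrace>x, dP y\<rbrace>\<^bsub>P\<^esub> \<and>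
      \<phi> \<lbrace>x, y\<rbrace>\<^bsub>P\<^esub> + dV (H x y + \<rho> x w - \<rho> y v) =
        (H (dP x) y + \<rho> (dP x) w - \<rho> y (\<phi> x + dV v)) +
        (H x (dP y) + \<rho> x (\<phi> y + dV w) - \<rho> (dP y) v))"
    (is "_ \<longleftrightarrow> ?mid")
    unfolding coord_mult coord_brk assemble_coord coord_add coord_eq_iff ..
  also have "\<dots> \<longleftrightarrow> ?rhs"
  proof
    assume m: ?mid
    note m1 = m[THEN conjunct1, rule_format] and m2 = m[THEN conjunct2, rule_format]
    \<comment> \<open>Pairing \<open>s x\<close> with an element of \<open>V\<close> makes all terms
      in \<open>h\<close>, \<open>H\<close> and \<open>\<phi>\<close> vanish, which isolates
      compatibility.\<close>
    have "dV (\<mu> x v) = \<mu> (dP x) v + \<mu> x (dV v)" "dV (\<rho> x v) = \<rho> (dP x) v + \<rho> x (dV v)" for x v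
      using m1[where x = x and v = 0 and y = 0 and w = v]
        m2[where x = x and v = 0 and y = 0 and w = v]
      by (simp_all add: V_simps P_simps \<phi>_simps mu_simps rho_simps h_simps H_simps
          mult_simps brk_simps)
    \<comment> \<open>Pairing two elements of the image of \<open>s\<close> isolates the cocycle
      condition.\<close>
    moreover have "deform (dV, dP) h x y = \<mu> x (\<phi> y) - \<phi> (x \<odot>\<^bsub>P\<^esub> y) + \<mu> y (\<phi> x)"
      "deform (dV, dP) H x y = \<rho> x (\<phi> y) - \<phi> \<lbrace>x, y\<rbrace>\<^bsub>P\<^esub> - \<rho> y (\<phi> x)" for x y
      using m1[where x = x and v = 0 and y = y and w = 0]
        m2[where x = x and v = 0 and y = y and w = 0]
      by (simp_all add: deform_def V_simps mu_simps rho_simps algebra_simps)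
    ultimately show ?rhs
      using m1 m2 dV dP by (auto simp: compat_Der_iff poisson_Der_def)
  next
    assume ?rhs
    \<comment> \<open>The cocycle conditions are solved for \<open>dV (h x y)\<close> and
      \<open>dV (H x y)\<close>, the only terms in the coordinate identities that compatibility and
      linearity leave unexpanded.\<close>
    then have c: "(dV, dP) \<in> vcarrier (compat_Der P sV \<mu> \<rho>)"
      and *: "dV (h x y) = \<mu> x (\<phi> y) - \<phi> (x \<odot>\<^bsub>P\<^esub> y) + \<mu> y (\<phi> x) + h (dP x) y + h x (dP y)"
       "dV (H x y) = \<rho> x (\<phi> y) - \<phi> \<lbrace>x, y\<rbrace>\<^bsub>P\<^esub> - \<rho> y (\<phi> x) + H (dP x) y + H x (dP y)" for x y
      by (simp_all add: deform_def diff_eq_eq)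
    show ?mid
      by (simp add: compat_DerD(3-6)[OF c] * V_simps mu_simps rho_simps)
  qed
  finally show ?thesis .
qed

lemma Der_ext_iff:
  "d \<in> vcarrier (Der_ext E i) \<longleftrightarrow> d \<in> poisson_Der E \<and> d ` range i \<subseteq> range i"
  by (simp add: Der_ext_def sub_vspace_def)

text \<open>A block triangular map with linear entries preserves \<open>V\<close> because
  \<open>dP 0 = 0\<close>, so only the derivation criterion is left.\<close>

lemma assemble_Der_ext_iff:
  assumes dV: "Vector_Spaces.linear sV sV dV"
    and dP: "Vector_Spaces.linear (pscale P) (pscale P) dP"
    and \<phi>: "Vector_Spaces.linear (pscale P) sV \<phi>"
  shows "assemble dV dP \<phi> \<in> vcarrier (Der_ext E i) \<longleftrightarrow>
    (dV, dP) \<in> vcarrier (compat_Der P sV \<mu> \<rho>) \<and>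
    (\<forall>x y. deform (dV, dP) h x y = \<mu> x (\<phi> y) - \<phi> (x \<odot>\<^bsub>P\<^esub> y) + \<mu> y (\<phi> x)) \<and>
    (\<forall>x y. deform (dV, dP) H x y = \<rho> x (\<phi> y) - \<phi> \<lbrace>x, y\<rbrace>\<^bsub>P\<^esub> - \<rho> y (\<phi> x))"
proof -
  have "assemble dV dP \<phi> ` range i \<subseteq> range i"
    by (auto simp: assemble_i linear_simps[OF dP] s_simps)
  then show ?thesis
    using assemble_poisson_Der_iff[OF assms] by (simp add: Der_ext_iff)
qed

text \<open>A normal form: exactness arguments about derivations preserving \<open>V\<close> become
  computations with the three entries.\<close>

lemma Der_ext_cases:
  assumes "d \<in> vcarrier (Der_ext E i)"
  obtains dV dP \<phi> where "d = assemble dV dP \<phi>" "Vector_Spaces.linear sV sV dV"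
    "Vector_Spaces.linear (pscale P) (pscale P) dP" "Vector_Spaces.linear (pscale P) sV \<phi>"
proof -
  have "Vector_Spaces.linear (pscale E) (pscale E) d" and V: "d ` range i \<subseteq> range i"
    using assms by (simp_all add: Der_ext_iff poisson_Der_def)
  note d = this
  show thesis
    by (rule that[OF assemble_of_linear[OF d]];
      intro linear_comp[OF linear_comp[OF _ d(1)]] linear_i linear_s linear_retr linear_p)
qed

text \<open>The map \<open>eta_map\<close> reads off the diagonal and forgets \<open>\<phi>\<close>,
  which disappears on \<open>V\<close> because \<open>\<phi> 0 = 0\<close> and on the image of
  \<open>s\<close> because \<open>p\<close> kills \<open>V\<close>.\<close>

lemma eta_map_assemble:
  assumes "Vector_Spaces.linear sV sV dV" "Vector_Spaces.linear (pscale P) (pscale P) dP"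
    "Vector_Spaces.linear (pscale P) sV \<phi>"
  shows "eta_map i p s (assemble dV dP \<phi>) = (dV, dP)"
  by (simp add: eta_map_def fun_eq_iff assemble_i assemble_s linear_simps[OF assms(1)]
      linear_simps[OF assms(2)] linear_simps[OF assms(3)] s_simps)

text \<open>Since \<open>d\<close> preserves \<open>V\<close>, the inverse \<open>inv i\<close> can
  be replaced by \<open>retr\<close>, which is linear on all of \<open>E\<close>; linearity of
  \<open>eta_map\<close> is then immediate.\<close>

lemma eta_map_eq:
  assumes "d \<in> vcarrier (Der_ext E i)"
  shows "eta_map i p s d = (\<lambda>v. retr (d (i v)), \<lambda>x. p (d (s x)))"
proof -
  have "p (d (i v)) = 0" for v
    using assms range_i by (auto simp: Der_ext_iff)
  then show ?thesis
    by (simp add: eta_map_def retr_def fun_eq_iff s_simps)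
qed

lemma vspace_Der_ext: "vspace (Der_ext E i)"
proof -
  interpret F: vector_space "fun_scale (pscale E) :: _ \<Rightarrow> ('e \<Rightarrow> 'e) \<Rightarrow> _"
    by (rule vector_space_fun_scale[OF E.vector_space])
  have "F.subspace {d. d ` range i \<subseteq> range i}"
    by (simp add: F.subspace_def range_i image_subset_iff p_simps fun_scale_def)
  from F.subspace_inter[OF E.poisson_Der_subspace this] show ?thesis
    unfolding Der_ext_def by (intro F.vspace_sub_vspace) (simp add: Int_def)
qed

lemma vlinear_eta_map: "vlinear (Der_ext E i) (compat_Der P sV \<mu> \<rho>) (eta_map i p s)"
  unfolding vlinear_def
proof (intro conjI ballI allI vspace_Der_ext vspace_compat_Der)
  show "eta_map i p s \<in> vcarrier (Der_ext E i) \<rightarrow> vcarrier (compat_Der P sV \<mu> \<rho>)"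
  proof
    fix d assume d: "d \<in> vcarrier (Der_ext E i)"
    then show "eta_map i p s d \<in> vcarrier (compat_Der P sV \<mu> \<rho>)"
      by (cases rule: Der_ext_cases) (use d in \<open>simp add: eta_map_assemble assemble_Der_ext_iff\<close>)
  qed
next
  fix d d' assume d: "d \<in> vcarrier (Der_ext E i)" "d' \<in> vcarrier (Der_ext E i)"
  then have "d + d' \<in> vcarrier (Der_ext E i)"
    using vspace.add_closed[OF vspace_Der_ext] by (simp add: Der_ext_def sub_vspace_def)
  with d show "eta_map i p s (vadd (Der_ext E i) d d') =
      vadd (compat_Der P sV \<mu> \<rho>) (eta_map i p s d) (eta_map i p s d')"
    by (simp add: Der_ext_def compat_Der_def sub_vspace_def
        eta_map_eq[unfolded Der_ext_def sub_vspace_def]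
        retr_simps p_simps plus_prod_def fun_eq_iff)
next
  fix c d assume d: "d \<in> vcarrier (Der_ext E i)"
  then have "fun_scale (pscale E) c d \<in> vcarrier (Der_ext E i)"
    using vspace.scale_closed[OF vspace_Der_ext] by (simp add: Der_ext_def sub_vspace_def)
  with d show "eta_map i p s (vscale (Der_ext E i) c d) =
      vscale (compat_Der P sV \<mu> \<rho>) c (eta_map i p s d)"
    by (simp add: Der_ext_def compat_Der_def sub_vspace_def
        eta_map_eq[unfolded Der_ext_def sub_vspace_def]
        retr_simps p_simps pair_scale_def fun_scale_def)
qed

section \<open>The map iota: exactness at Der(P, V) and at the derivations of E preserving V\<close>

lemma iota_map_eq_assemble: "iota_map i p D = assemble 0 0 D"
  by (simp add: iota_map_def assemble_def fun_eq_iff s_simps)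

lemma linear_zeros: "Vector_Spaces.linear sV sV 0" "Vector_Spaces.linear (pscale P) (pscale P) 0"
  by (simp_all add: linear_zero VV.vector_space_axioms vector_space)

text \<open>For zero diagonal the deformed cocycle is zero, so the derivation criterion says that
  the differential of \<open>D\<close> vanishes, which is the pair of derivation equations for
  \<open>D\<close>.\<close>

lemma Der_rep_iff:
  "D \<in> vcarrier (Der_rep P sV \<mu> \<rho>) \<longleftrightarrow> Vector_Spaces.linear (pscale P) sV D \<and>
     assemble 0 0 D \<in> vcarrier (Der_ext E i)"
proof -
  have "(0, 0) \<in> vcarrier (compat_Der P sV \<mu> \<rho>)"
    using vspace.zero_closed[OF vspace_compat_Der]
    by (simp add: compat_Der_def sub_vspace_def zero_prod_def)
  moreover have "(D (x \<odot>\<^bsub>P\<^esub> y) = \<mu> x (D y) + \<mu> y (D x)) \<longleftrightarrow>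
      deform (0, 0) h x y = \<mu> x (D y) - D (x \<odot>\<^bsub>P\<^esub> y) + \<mu> y (D x)"
    "(D \<lbrace>x, y\<rbrace>\<^bsub>P\<^esub> = \<rho> x (D y) - \<rho> y (D x)) \<longleftrightarrow>
      deform (0, 0) H x y = \<rho> x (D y) - D \<lbrace>x, y\<rbrace>\<^bsub>P\<^esub> - \<rho> y (D x)" for x y
    by (auto simp: deform_def h_simps H_simps algebra_simps)
  ultimately show ?thesis
    using assemble_Der_ext_iff[OF linear_zeros, of D]
    by (auto simp: Der_rep_def sub_vspace_def)
qed

lemma vlinear_iota_map: "vlinear (Der_rep P sV \<mu> \<rho>) (Der_ext E i) (iota_map i p)"
  unfolding vlinear_def
proof (intro conjI ballI allI vspace_Der_ext vspace_Der_rep)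
  show "iota_map i p \<in> vcarrier (Der_rep P sV \<mu> \<rho>) \<rightarrow> vcarrier (Der_ext E i)"
    by (simp add: iota_map_eq_assemble Der_rep_iff)
qed (auto simp: iota_map_def Der_rep_def Der_ext_def sub_vspace_def fun_scale_def i_simps)

text \<open>Injectivity: every \<open>x\<close> is the image under \<open>p\<close> of
  \<open>s x\<close>, and \<open>i\<close> is injective.\<close>

lemma vkernel_iota_map: "vkernel (Der_rep P sV \<mu> \<rho>) (Der_ext E i) (iota_map i p) = {0}"
proof -
  have "D = 0" if "iota_map i p D = 0" for D
  proof
    fix x
    show "D x = 0 x"
      using fun_cong[OF that, of "s x"] i_eq_iff[of _ 0] by (simp add: iota_map_def i_simps)
  qed
  moreover have "0 \<in> vcarrier (Der_rep P sV \<mu> \<rho>)"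
    using vspace.zero_closed[OF vspace_Der_rep] by (simp add: Der_rep_def sub_vspace_def)
  ultimately show ?thesis
    by (auto simp: vkernel_def Der_ext_def sub_vspace_def iota_map_def i_simps)
qed

text \<open>An element of the kernel of \<open>eta_map\<close> is a block matrix with zero diagonal,
  hence \<open>iota_map i p \<phi>\<close> for its off-diagonal entry, and
  \<open>Der_rep_iff\<close> places \<open>\<phi>\<close> in Der(P, V).\<close>

lemma image_iota_map:
  "iota_map i p ` vcarrier (Der_rep P sV \<mu> \<rho>) =
    vkernel (Der_ext E i) (compat_Der P sV \<mu> \<rho>) (eta_map i p s)"
proof -
  have [simp]: "vzero (compat_Der P sV \<mu> \<rho>) = (0, 0)"
    by (simp add: compat_Der_def sub_vspace_def zero_prod_def)
  show ?thesis
  proof (intro equalityI subsetI)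
    fix d assume "d \<in> iota_map i p ` vcarrier (Der_rep P sV \<mu> \<rho>)"
    then show "d \<in> vkernel (Der_ext E i) (compat_Der P sV \<mu> \<rho>) (eta_map i p s)"
      by (auto simp: vkernel_def iota_map_eq_assemble Der_rep_iff eta_map_assemble linear_zeros)
  next
    fix d assume "d \<in> vkernel (Der_ext E i) (compat_Der P sV \<mu> \<rho>) (eta_map i p s)"
    then have d: "d \<in> vcarrier (Der_ext E i)" "eta_map i p s d = (0, 0)"
      by (simp_all add: vkernel_def)
    from d(1) show "d \<in> iota_map i p ` vcarrier (Der_rep P sV \<mu> \<rho>)"
    proof (cases rule: Der_ext_cases)
      case (1 dV dP \<phi>)
      with d(2) have "dV = 0" "dP = 0"
        by (simp_all add: eta_map_assemble)
      with 1 d(1) show ?thesis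
        by (auto simp: iota_map_eq_assemble Der_rep_iff)
    qed
  qed
qed

section \<open>The Wells map and exactness at the compatible pairs\<close>

lemma wells_map_eq:
  "wells_map P sV \<mu> \<rho> E i s d = coho_class P sV \<mu> \<rho> (deform d h, deform d H)"
  by (simp add: wells_map_def section_cocycle)

lemmas deform_section_cocycle = deform_cocycles2[OF _ section_cocycle_in_cocycles2]

text \<open>For fixed \<open>h\<close> and \<open>H\<close>, bilinearity makes the deformation
  linear in the pair already on cochains, and passing to classes is linear.\<close>

lemma vlinear_wells_map:
  "vlinear (compat_Der P sV \<mu> \<rho>) (H2_FGV P sV \<mu> \<rho>) (wells_map P sV \<mu> \<rho> E i s)"
  unfolding vlinear_def
proof (intro conjI ballI allI vspace_compat_Der vspace_H2_FGV)
  show "wells_map P sV \<mu> \<rho> E i s \<in> vcarrier (compat_Der P sV \<mu> \<rho>) \<rightarrow> vcarrier (H2_FGV P sV \<mu> \<rho>)"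
    by (auto simp: wells_map_eq coho_class_def H2_FGV_def intro!: quotientI deform_section_cocycle)
next
  fix d d' assume d: "d \<in> vcarrier (compat_Der P sV \<mu> \<rho>)" "d' \<in> vcarrier (compat_Der P sV \<mu> \<rho>)"
  have "(deform (d + d') h, deform (d + d') H) =
      (deform d h, deform d H) + (deform d' h, deform d' H)"
    by (simp add: deform_def split_def fun_eq_iff h_simps H_simps)
  then show "wells_map P sV \<mu> \<rho> E i s (vadd (compat_Der P sV \<mu> \<rho>) d d') =
      vadd (H2_FGV P sV \<mu> \<rho>) (wells_map P sV \<mu> \<rho> E i s d) (wells_map P sV \<mu> \<rho> E i s d')"
    using coho_class_add[OF deform_section_cocycle[OF d(1)] deform_section_cocycle[OF d(2)]]
    by (simp add: wells_map_eq compat_Der_def sub_vspace_def)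
next
  fix c d assume d: "d \<in> vcarrier (compat_Der P sV \<mu> \<rho>)"
  let ?cd = "pair_scale (fun_scale sV) (fun_scale (pscale P)) c d"
  have "(deform ?cd h, deform ?cd H) = cochain_scale c (deform d h, deform d H)"
    by (simp add: deform_def split_def fun_eq_iff h_simps H_simps pair_scale_def fun_scale_def
        VV.scale_right_diff_distrib)
  then show "wells_map P sV \<mu> \<rho> E i s (vscale (compat_Der P sV \<mu> \<rho>) c d) =
      vscale (H2_FGV P sV \<mu> \<rho>) c (wells_map P sV \<mu> \<rho> E i s d)"
    using coho_class_scale[OF deform_section_cocycle[OF d], of c]
    by (simp add: wells_map_eq compat_Der_def sub_vspace_def)
qed

text \<open>Both inclusions are the derivation criterion: the off-diagonal entry of a derivation
  exhibits the deformed cocycle of its diagonal as a coboundary, and conversely.\<close>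

lemma image_eta_map:
  "eta_map i p s ` vcarrier (Der_ext E i) =
    vkernel (compat_Der P sV \<mu> \<rho>) (H2_FGV P sV \<mu> \<rho>) (wells_map P sV \<mu> \<rho> E i s)"
proof -
  have ker: "d \<in> vkernel (compat_Der P sV \<mu> \<rho>) (H2_FGV P sV \<mu> \<rho>) (wells_map P sV \<mu> \<rho> E i s) \<longleftrightarrow>
      d \<in> vcarrier (compat_Der P sV \<mu> \<rho>) \<and> (deform d h, deform d H) \<in> coboundaries2 P sV \<mu> \<rho>" for d
    unfolding vkernel_def wells_map_eq mem_Collect_eq
    using coho_class_eq_zero_iff[OF deform_section_cocycle] by blast
  show ?thesis
  proof (intro equalityI subsetI)
    fix c assume "c \<in> eta_map i p s ` vcarrier (Der_ext E i)"
    then obtain d where d: "d \<in> vcarrier (Der_ext E i)" "c = eta_map i p s d"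
      by blast
    from d(1) show "c \<in> vkernel (compat_Der P sV \<mu> \<rho>) (H2_FGV P sV \<mu> \<rho>) (wells_map P sV \<mu> \<rho> E i s)"
    proof (cases rule: Der_ext_cases)
      case (1 dV dP \<phi>)
      then show ?thesis
        using d assemble_Der_ext_iff[OF 1(2-4)]
        by (auto simp: ker eta_map_assemble coboundaries2_def)
    qed
  next
    fix c assume "c \<in> vkernel (compat_Der P sV \<mu> \<rho>) (H2_FGV P sV \<mu> \<rho>) (wells_map P sV \<mu> \<rho> E i s)"
    moreover obtain dV dP where c: "c = (dV, dP)"
      by fastforce
    ultimately obtain \<phi> where *: "(dV, dP) \<in> vcarrier (compat_Der P sV \<mu> \<rho>)"
      "Vector_Spaces.linear (pscale P) sV \<phi>"
      "\<forall>x y. deform (dV, dP) h x y = \<mu> x (\<phi> y) - \<phi> (x \<odot>\<^bsub>P\<^esub> y) + \<mu> y (\<phi> x)"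
      "\<forall>x y. deform (dV, dP) H x y = \<rho> x (\<phi> y) - \<phi> \<lbrace>x, y\<rbrace>\<^bsub>P\<^esub> - \<rho> y (\<phi> x)"
      by (auto simp: ker coboundaries2_def)
    note lin = compat_DerD(1,2)[OF *(1)] *(2)
    \<comment> \<open>The lift of the pair uses the map \<open>\<phi>\<close> that witnesses the
      vanishing of its Wells class as off-diagonal entry.\<close>
    have "assemble dV dP \<phi> \<in> vcarrier (Der_ext E i)"
      using * assemble_Der_ext_iff[OF lin] by blast
    then show "c \<in> eta_map i p s ` vcarrier (Der_ext E i)"
      using eta_map_assemble[OF lin] c by (metis imageI)
  qed
qed

lemma wells_exact_sequence:
  "exact_0_4
    (Der_rep P sV \<mu> \<rho>) (iota_map i p)
    (Der_ext E i) (eta_map i p s)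
    (compat_Der P sV \<mu> \<rho>) (wells_map P sV \<mu> \<rho> E i s)
    (H2_FGV P sV \<mu> \<rho>)"
  unfolding exact_0_4_def
  by (intro conjI vlinear_iota_map vlinear_eta_map vlinear_wells_map image_iota_map image_eta_map)
    (simp add: vkernel_iota_map, simp add: Der_rep_def sub_vspace_def)

end

theorem theorem4p4:
  fixes P :: "('k::field_char_0, 'p::ab_group_add) poisson"
    and sV :: "'k \<Rightarrow> 'v::ab_group_add \<Rightarrow> 'v"
    and \<mu> \<rho> :: "'p \<Rightarrow> 'v \<Rightarrow> 'v"
    and E :: "('k, 'e::ab_group_add) poisson"
    and i :: "'v \<Rightarrow> 'e" and p :: "'e \<Rightarrow> 'p" and s :: "'p \<Rightarrow> 'e"
  assumes "poisson_algebra P"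
    and "poisson_rep P sV \<mu> \<rho>"
    and "abelian_extension P sV \<mu> \<rho> E i p"
    and "linear_section P E p s"
  shows "exact_0_4
    (Der_rep P sV \<mu> \<rho>) (iota_map i p)
    (Der_ext E i) (eta_map i p s)
    (compat_Der P sV \<mu> \<rho>) (wells_map P sV \<mu> \<rho> E i s)
    (H2_FGV P sV \<mu> \<rho>)"
proof -
  interpret sectioned_extension P sV \<mu> \<rho> E i p s
    using assms by (simp add: sectioned_extension_def sectioned_extension_axioms_def)
  show ?thesis
    by (rule wells_exact_sequence)
qed

end
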